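(* Let $X\ge 1$, $y\ge 2$ and $f(y)>0$ be real numbers. If $$|Q(x,y)| \le x f(y) \quad \text{for all } 1\le x \le X,$$ then $$|R(x,y)| \le x f(y) \Pi(y)^{-1} \quad \text{for all } 0 < x \le X$$ and $$|\Delta(x,y)| \le 2 x f(y) \Pi(y)^{-1} \quad \text{for all } 1\le x \le X.$$ This also holds if $(Q,R)$ is replaced by $(Q^*,R^* )$; that is, if $|Q^*(x,y)|\le xf(y)$ for all $1\le x\le X$, then $|R^*(x,y)|\le xf(y)\Pi(y)^{-1}$ for all $0<x\le X$ and $|\Delta(x,y)|\le 2xf(y)\Pi(y)^{-1}$ for all $1\le x\le X$.
   Context: Notation. $\gamma$ is Euler's constant; $\{x\}$ is the fractional part of $x$; $p$ denotes primes; $1_{x\ge1}$ equals $1$ if $x\ge 1$ and $0$ otherwise. Throughout $u=\log x/\log y$. $\rho$ is Dickman's function: $\rho(u)=0$ for $u<0$, $\rho(u)=1$ for $0\le u\le 1$, $\rho$ is continuous on $[0,\infty)$ and $u\rho'(u)=-\rho(u-1)$ for $u>1$; $\rho'(u)$ is defined by right-continuity at $u=0,1$ (so $\rho'(0)=0$, $\rho'(1)=-1$). $\omega$ is Buchstab's function: $\omega(u)=0$ for $u<1$, $\omega(u)=1/u$ for $1\le u\le 2$, $\omega$ is continuous on $[1,\infty)$ and $(u\omega(u))'=\omega(u-1)$ for $u>2$. $\mathcal S_y$ is the set of positive integers all of whose prime factors are $\le y$ (so $1\in\mathcal S_y$). $\Psi(x,y)=|\mathcal S_y\cap[1,x]|$.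 $\Phi(x,y)$ is the number of integers $1\le n\le x$ all of whose prime factors are $>y$ (including $n=1$). $\Pi(y)=\prod_{p\le y}(1-1/p)$. $\mu_y(u)=\int_0^u \omega(u-v)y^{-v}\,dv$ (so $\mu_y(u)=0$ for $u<1$, including $u<0$). For $x\ge1$, $y\ge2$: $$\Lambda(x,y)= x \rho(u)-\{x\}-x\int_0^u \rho'(u-v) \frac{\{y^v\}}{y^v}\, dv,\qquad \Delta(x,y)=\Psi(x,y)-\Lambda(x,y).$$ For $x>0$, $y\ge 2$: $$V(x,y)=1_{x\ge 1} + x \Big( \Pi(y) - \frac{e^{-\gamma}}{\log y} +\mu_y(u)\Big),\qquad V^*(x,y)=1_{x\ge 1} + x \mu_y(u),$$ $$Q(x,y)=V(x,y)-\Phi(x,y),\qquad Q^*(x,y)=V^*(x,y)-\Phi(x,y),$$ $$R(x,y)=\sum_{n\in\mathcal S_y}Q(x/n,y),\qquad R^*(x,y)=\sum_{n\in\mathcal S_y}Q^*(x/n,y),$$ where the sums are over all of the set $\mathcal S_y$ (they converge absolutely). *)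

theory Defs
  imports "HOL-Analysis.Analysis" "HOL-Computational_Algebra.Primes"
begin

definition is_dickman :: "(real \<Rightarrow> real) \<Rightarrow> bool" where
  "is_dickman r \<longleftrightarrow>
     (\<forall>u<0. r u = 0) \<and> (\<forall>u\<in>{0..1}. r u = 1) \<and> continuous_on {0..} r \<and>
     (\<forall>u>1. r differentiable (at u) \<and> u * deriv r u = - r (u - 1))"

definition dickman :: "real \<Rightarrow> real" where
  "dickman = (THE r. is_dickman r)"

definition is_buchstab :: "(real \<Rightarrow> real) \<Rightarrow> bool" where
  "is_buchstab w \<longleftrightarrow>
     (\<forall>u<1. w u = 0) \<and> (\<forall>u\<in>{1..2}. w u = 1 / u) \<and> continuous_on {1..} w \<and>
     (\<forall>u>2. ((\<lambda>t. t * w t) has_real_derivative w (u - 1)) (at u))"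

definition buchstab :: "real \<Rightarrow> real" where
  "buchstab = (THE w. is_buchstab w)"

text \<open>
  Both functions are well defined. With \<open>a = 1\<close>, \<open>k u = - 1 / u\<close> the following delay equation
  is the one for Dickman's function; with \<open>a = 2\<close>, \<open>k u = 1 / (u - 1)\<close> it is the one for
  \<open>u\<close> times Buchstab's function.
\<close>

definition delay_solution :: "real \<Rightarrow> (real \<Rightarrow> real) \<Rightarrow> (real \<Rightarrow> real) \<Rightarrow> bool" where
  "delay_solution a k g \<longleftrightarrow>
     (\<forall>u<a-1. g u = 0) \<and> (\<forall>u\<in>{a-1..a}. g u = 1) \<and> continuous_on {a-1..} g \<and>
     (\<forall>u>a. (g has_real_derivative k u * g (u - 1)) (at u))"

primrec delay_iter :: "real \<Rightarrow> (real \<Rightarrow> real) \<Rightarrow> nat \<Rightarrow> real \<Rightarrow> real" where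
  "delay_iter a k 0 u = (if u < a - 1 then 0 else 1)"
| "delay_iter a k (Suc n) u =
     (if u < a - 1 then 0 else if u \<le> a then 1
      else 1 + integral {a..u} (\<lambda>t. k t * delay_iter a k n (t - 1)))"

lemma delay_integrand_continuous:
  fixes a :: real and k g :: "real \<Rightarrow> real"
  assumes "continuous_on {a..} k" "continuous_on {a-1..} g"
  shows "continuous_on {a..} (\<lambda>t. k t * g (t - 1))"
  by (rule continuous_on_mult[OF assms(1)])
    (rule continuous_on_compose2[OF assms(2)], auto intro!: continuous_intros)

lemma delay_integral_continuous:
  fixes a :: real and h :: "real \<Rightarrow> real"
  assumes "continuous_on {a..} h"
  shows "continuous_on {a-1..} (\<lambda>u. if u \<le> a then 1 else 1 + integral {a..u} h)"
proof -
  have I: "continuous_on {a..b} (\<lambda>u. 1 + integral {a..u} h)" for b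
    by (rule continuous_on_add[OF continuous_on_const], rule indefinite_integral_continuous_1,
        rule integrable_continuous_interval, rule continuous_on_subset[OF assms]) auto
  have "continuous_on {a..} (\<lambda>u. 1 + integral {a..u} h)"
    unfolding continuous_on_eq_continuous_within
  proof
    fix x assume x: "x \<in> {a..}"
    have "continuous (at x within {a..x+1}) (\<lambda>u. 1 + integral {a..u} h)"
      using I[of "x+1"] x by (auto simp: continuous_on_eq_continuous_within)
    moreover have "at x within {a..x+1} = at x within {a..}"
      by (rule at_within_nhd[of _ "{..<x+1}"]) auto
    ultimately show "continuous (at x within {a..}) (\<lambda>u. 1 + integral {a..u} h)" by simp
  qed
  then have "continuous_on ({a-1..a} \<union> {a..}) (\<lambda>u. if u \<le> a then 1 else 1 + integral {a..u} h)"
    by (intro continuous_on_If) (auto intro: order.antisym)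
  moreover have "{a-1..a} \<union> {a..} = {a-1..}" by auto
  ultimately show ?thesis by simp
qed

lemma delay_iter_continuous:
  assumes "continuous_on {a..} k"
  shows "continuous_on {a-1..} (delay_iter a k n)"
proof (induction n)
  case 0
  have "continuous_on {a-1..} (\<lambda>_::real. 1::real)" by simp
  then show ?case by (rule continuous_on_eq) auto
next
  case (Suc n)
  show ?case
    by (rule continuous_on_eq[OF delay_integral_continuous
          [OF delay_integrand_continuous[OF assms Suc]]]) auto
qed

lemma delay_iter_Suc_eq:
  "u \<le> a + real n \<Longrightarrow> delay_iter a k (Suc n) u = delay_iter a k n u"
proof (induction n arbitrary: u)
  case 0
  then show ?case by simp
next
  case (Suc n)
  have "integral {a..u} (\<lambda>t. k t * delay_iter a k (Suc n) (t - 1)) =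
        integral {a..u} (\<lambda>t. k t * delay_iter a k n (t - 1))"
    using Suc by (intro integral_cong) (auto simp del: delay_iter.simps)
  then show ?case by (simp only: delay_iter.simps)
qed

lemma delay_iter_eq:
  assumes "n \<le> m" "u \<le> a + real n"
  shows "delay_iter a k m u = delay_iter a k n u"
  using assms
proof (induction m rule: dec_induct)
  case base
  then show ?case by simp
next
  case (step m)
  then show ?case using delay_iter_Suc_eq[of u a m k] by simp
qed

lemma delay_solution_exists:
  assumes k: "continuous_on {a..} k"
  shows "\<exists>g. delay_solution a k g"
proof -
  define N where "N u = nat \<lceil>u - a\<rceil>" for u
  define g where "g u = delay_iter a k (N u) u" for u
  have N: "u \<le> a + real (N u)" for u unfolding N_def by linarith
  have g: "g u = delay_iter a k m u" if "u \<le> a + real m" for u m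
  proof (cases "m \<le> N u")
    case True
    then show ?thesis unfolding g_def using that by (rule delay_iter_eq)
  next
    case False
    then show ?thesis unfolding g_def using N[of u] by (intro delay_iter_eq[symmetric]) auto
  qed
  have gcont: "continuous_on {a-1..} g"
    unfolding continuous_on_eq_continuous_within
  proof
    fix x assume x: "x \<in> {a-1..}"
    define m where "m = N (x + 1)"
    have m: "x + 1 \<le> a + real m" using N m_def by blast
    have "continuous (at x within {a-1..}) (delay_iter a k m)"
      using delay_iter_continuous[OF k, of m] x by (auto simp: continuous_on_eq_continuous_within)
    then show "continuous (at x within {a-1..}) g"
    proof (rule continuous_transform_within[where \<delta> = 1])
      fix z assume "z \<in> {a-1..}" "dist z x < 1"
      then have "z \<le> a + real m" using m by (auto simp: dist_real_def)
      then show "delay_iter a k m z = g z" by (simp add: g)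
    qed (use x in auto)
  qed
  define h where "h t = k t * g (t - 1)" for t
  have hcont: "continuous_on {a..} h"
    unfolding h_def by (rule delay_integrand_continuous[OF k gcont])
  have gint: "g u = 1 + integral {a..u} h" if "u > a" for u
  proof -
    have "u \<le> a + real (Suc (N u))" using N[of u] by simp
    then have "g u = delay_iter a k (Suc (N u)) u" by (rule g)
    also have "\<dots> = 1 + integral {a..u} (\<lambda>t. k t * delay_iter a k (N u) (t - 1))"
      using that by simp
    also have "integral {a..u} (\<lambda>t. k t * delay_iter a k (N u) (t - 1)) = integral {a..u} h"
    proof (rule integral_cong)
      fix t assume "t \<in> {a..u}"
      then have "t - 1 \<le> a + real (N u)" using N[of u] by auto
      then show "k t * delay_iter a k (N u) (t - 1) = h t" by (simp add: h_def g)
    qed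
    finally show ?thesis .
  qed
  have deriv: "(g has_real_derivative k u * g (u - 1)) (at u)" if "u > a" for u
  proof -
    have "((\<lambda>u. integral {a..u} h) has_real_derivative h u) (at u within {a..u+1})"
      using that by (intro integral_has_real_derivative continuous_on_subset[OF hcont]) auto
    moreover have "at u within {a..u+1} = at u"
      using that by (intro at_within_interior) auto
    ultimately have "((\<lambda>u. 1 + integral {a..u} h) has_real_derivative h u) (at u)"
      by (auto intro!: derivative_eq_intros)
    then have "(g has_real_derivative h u) (at u)"
      by (rule has_field_derivative_transform_within_open[of _ _ _ "{a<..}"])
        (use that gint in auto)
    then show ?thesis by (simp add: h_def)
  qed
  have "g u = 0" if "u < a - 1" for u using g[of u 0] that by simp
  moreover have "g u = 1" if "u \<in> {a-1..a}" for u using g[of u 0] that by simp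
  ultimately show ?thesis
    unfolding delay_solution_def using gcont deriv by blast
qed

lemma delay_solution_unique:
  assumes f: "delay_solution a k f" and g: "delay_solution a k g"
  shows "f = g"
proof -
  have eq: "f u = g u" if "u \<le> a + real n" for u n
    using that
  proof (induction n arbitrary: u)
    case 0
    then show ?case using f g unfolding delay_solution_def
      by (metis add.right_neutral atLeastAtMost_iff linorder_not_less of_nat_0)
  next
    case (Suc n)
    show ?case
    proof (cases "u \<le> a + real n")
      case True
      then show ?thesis by (rule Suc.IH)
    next
      case False
      define b where "b = a + real n"
      have b: "a \<le> b" "b < u" "u \<le> b + 1" using False Suc.prems by (auto simp: b_def)
      have "f u - g u = f b - g b"
      proof (rule DERIV_isconst_end[OF b(2)])
        have "continuous_on {a-1..} (\<lambda>x. f x - g x)"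
          using f g unfolding delay_solution_def by (intro continuous_intros) auto
        then show "continuous_on {b..u} (\<lambda>x. f x - g x)"
          by (rule continuous_on_subset) (use b in auto)
        fix x assume x: "b < x" "x < u"
        have "f (x - 1) = g (x - 1)" using Suc.IH[of "x - 1"] x b by (auto simp: b_def)
        moreover have "((\<lambda>x. f x - g x) has_real_derivative
            k x * f (x - 1) - k x * g (x - 1)) (at x)"
          using f g x b unfolding delay_solution_def by (intro derivative_intros) auto
        ultimately show "((\<lambda>x. f x - g x) has_real_derivative 0) (at x)" by simp
      qed
      moreover have "f b = g b" using Suc.IH[of b] by (simp add: b_def)
      ultimately show ?thesis by simp
    qed
  qed
  show ?thesis
  proof
    fix u
    have "u \<le> a + real (nat \<lceil>u - a\<rceil>)" by linarith
    then show "f u = g u" by (rule eq)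
  qed
qed

lemma is_dickman_iff: "is_dickman r \<longleftrightarrow> delay_solution 1 (\<lambda>u. - 1 / u) r"
proof -
  have "(r differentiable (at u) \<and> u * deriv r u = - r (u - 1)) \<longleftrightarrow>
        (r has_real_derivative - 1 / u * r (u - 1)) (at u)" if "u > 1" for u
  proof
    assume *: "r differentiable (at u) \<and> u * deriv r u = - r (u - 1)"
    then have "(r has_real_derivative deriv r u) (at u)"
      by (meson DERIV_deriv_iff_real_differentiable)
    moreover have "deriv r u = - 1 / u * r (u - 1)"
      using * that by (simp add: field_simps)
    ultimately show "(r has_real_derivative - 1 / u * r (u - 1)) (at u)" by simp
  next
    assume *: "(r has_real_derivative - 1 / u * r (u - 1)) (at u)"
    then have "r differentiable (at u)" using real_differentiable_def by blast
    moreover have "deriv r u = - 1 / u * r (u - 1)" using * by (rule DERIV_imp_deriv)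
    ultimately show "r differentiable (at u) \<and> u * deriv r u = - r (u - 1)"
      using that by simp
  qed
  then show ?thesis unfolding is_dickman_def delay_solution_def by auto
qed

lemma is_buchstab_imp_delay:
  assumes "is_buchstab w"
  shows "delay_solution 2 (\<lambda>u. 1 / (u - 1)) (\<lambda>u. u * w u)"
proof -
  have "continuous_on {1..} (\<lambda>u. u * w u)"
    using assms unfolding is_buchstab_def by (intro continuous_intros) auto
  then show ?thesis using assms unfolding is_buchstab_def delay_solution_def by auto
qed

lemma delay_imp_is_buchstab:
  assumes g: "delay_solution 2 (\<lambda>u. 1 / (u - 1)) g"
  shows "is_buchstab (\<lambda>u. g u / u)"
proof -
  have "continuous_on {1..} (\<lambda>u. g u / u)"
    using g unfolding delay_solution_def by (intro continuous_intros) auto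
  moreover have "((\<lambda>t. t * (g t / t)) has_real_derivative g (u - 1) / (u - 1)) (at u)"
    if "u > 2" for u
  proof -
    have "(g has_real_derivative g (u - 1) / (u - 1)) (at u)"
      using g that unfolding delay_solution_def by auto
    then show ?thesis
      by (rule has_field_derivative_transform_within_open[of _ _ _ "{2<..}"]) (use that in auto)
  qed
  ultimately show ?thesis using g unfolding is_buchstab_def delay_solution_def by auto
qed

theorem ex1_dickman: "\<exists>!r. is_dickman r"
proof -
  have "continuous_on {1..} (\<lambda>u::real. - 1 / u)" by (intro continuous_intros) auto
  then show ?thesis
    unfolding is_dickman_iff using delay_solution_exists delay_solution_unique by blast
qed

theorem ex1_buchstab: "\<exists>!w. is_buchstab w"
proof -
  have "continuous_on {2..} (\<lambda>u::real. 1 / (u - 1))" by (intro continuous_intros) auto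
  then obtain g where "delay_solution 2 (\<lambda>u. 1 / (u - 1)) g"
    using delay_solution_exists by blast
  then have "is_buchstab (\<lambda>u. g u / u)" by (rule delay_imp_is_buchstab)
  moreover have "v = w" if vw: "is_buchstab v" "is_buchstab w" for v w
  proof
    fix u
    have "u * v u = u * w u"
      using delay_solution_unique[OF vw[THEN is_buchstab_imp_delay]] by meson
    moreover have "v u = w u" if "u = 0" using vw that unfolding is_buchstab_def by auto
    ultimately show "v u = w u" by auto
  qed
  ultimately show ?thesis by blast
qed

lemma is_dickman_dickman: "is_dickman dickman"
  unfolding dickman_def by (rule theI'[OF ex1_dickman])

lemma is_buchstab_buchstab: "is_buchstab buchstab"
  unfolding buchstab_def by (rule theI'[OF ex1_buchstab])

text \<open>At the two corners \<open>0\<close> and \<open>1\<close> of Dickman's function the derivative is the right limit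
  of the derivative.\<close>

definition dickman' :: "real \<Rightarrow> real" where
  "dickman' u = (if u = 0 \<or> u = 1 then Lim (at_right u) (deriv dickman) else deriv dickman u)"

lemma dickman'_0: "dickman' 0 = 0"
proof -
  have "deriv dickman u = 0" if "u \<in> {0<..<1}" for u
  proof -
    have "(dickman has_real_derivative 0) (at u)"
      by (rule has_field_derivative_transform_within_open[of "\<lambda>_. 1" _ _ "{0<..<1}"])
        (use that is_dickman_dickman in \<open>auto simp: is_dickman_def\<close>)
    then show ?thesis by (rule DERIV_imp_deriv)
  qed
  then have "eventually (\<lambda>u. 0 = deriv dickman u) (at_right 0)"
    using eventually_at_right_real[of 0 "1::real"] by (auto elim!: eventually_mono)
  then have "(deriv dickman \<longlongrightarrow> 0) (at_right 0)"
    by (rule Lim_transform_eventually[OF tendsto_const])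
  then show ?thesis by (simp add: dickman'_def tendsto_Lim)
qed

lemma dickman'_1: "dickman' 1 = -1"
proof -
  have "-1 / u = deriv dickman u" if "u \<in> {1<..<2}" for u
  proof -
    have "u * deriv dickman u = - dickman (u - 1)" "dickman (u - 1) = 1"
      using is_dickman_dickman that unfolding is_dickman_def by auto
    then show ?thesis using that by (simp add: field_simps)
  qed
  then have "eventually (\<lambda>u. -1 / u = deriv dickman u) (at_right 1)"
    using eventually_at_right_real[of 1 "2::real"] by (auto elim!: eventually_mono)
  moreover have "((\<lambda>u::real. -1 / u) \<longlongrightarrow> -1 / 1) (at_right 1)"
    by (intro tendsto_intros) auto
  ultimately have "(deriv dickman \<longlongrightarrow> -1 / 1) (at_right 1)"
    by (rule Lim_transform_eventually[rotated])
  then show ?thesis by (simp add: dickman'_def tendsto_Lim)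
qed

definition smooth_numbers :: "real \<Rightarrow> nat set" where
  "smooth_numbers y = {n. n > 0 \<and> (\<forall>p. prime p \<and> p dvd n \<longrightarrow> real p \<le> y)}"

definition Psi :: "real \<Rightarrow> real \<Rightarrow> nat" where
  "Psi x y = card {n \<in> smooth_numbers y. real n \<le> x}"

definition Phi :: "real \<Rightarrow> real \<Rightarrow> nat" where
  "Phi x y = card {n. n > 0 \<and> real n \<le> x \<and> (\<forall>p. prime p \<and> p dvd n \<longrightarrow> real p > y)}"

definition primes_prod :: "real \<Rightarrow> real" where
  "primes_prod y = (\<Prod>p | prime p \<and> real p \<le> y. 1 - 1 / real p)"

text \<open>For \<open>u < 0\<close> the interval is empty, so the value is \<open>0\<close>, as for the oriented integral, whose
  integrand vanishes on \<open>[u, 0]\<close>.\<close>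

definition mu :: "real \<Rightarrow> real \<Rightarrow> real" where
  "mu y u = integral {0..u} (\<lambda>v. buchstab (u - v) * y powr (- v))"

definition Lambda :: "real \<Rightarrow> real \<Rightarrow> real" where
  "Lambda x y =
     (let u = ln x / ln y in
      x * dickman u - frac x
        - x * integral {0..u} (\<lambda>v. dickman' (u - v) * (frac (y powr v) / y powr v)))"

definition Delta :: "real \<Rightarrow> real \<Rightarrow> real" where
  "Delta x y = real (Psi x y) - Lambda x y"

definition V :: "real \<Rightarrow> real \<Rightarrow> real" where
  "V x y = (if x \<ge> 1 then 1 else 0)
     + x * (primes_prod y - exp (- euler_mascheroni) / ln y + mu y (ln x / ln y))"

definition Vstar :: "real \<Rightarrow> real \<Rightarrow> real" where
  "Vstar x y = (if x \<ge> 1 then 1 else 0) + x * mu y (ln x / ln y)"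

definition Q :: "real \<Rightarrow> real \<Rightarrow> real" where
  "Q x y = V x y - real (Phi x y)"

definition Qstar :: "real \<Rightarrow> real \<Rightarrow> real" where
  "Qstar x y = Vstar x y - real (Phi x y)"

definition R :: "real \<Rightarrow> real \<Rightarrow> real" where
  "R x y = (\<Sum>\<^sub>\<infinity>n\<in>smooth_numbers y. Q (x / real n) y)"

definition Rstar :: "real \<Rightarrow> real \<Rightarrow> real" where
  "Rstar x y = (\<Sum>\<^sub>\<infinity>n\<in>smooth_numbers y. Qstar (x / real n) y)"

end

theory Submission
  imports Defs
begin

text \<open>
  Write \<open>f * g (u) = \<integral> f(u - t) g(t) dt\<close> for functions that vanish on the negative axis, and put
  \<open>x = y\<^sup>u\<close>. Every positive integer is uniquely the product of an integer in \<open>\<S>\<^sub>y\<close> and one without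
  prime factors up to \<open>y\<close>. Therefore, summing the definition of \<open>Q\<^sup>*(x/n,y)\<close> over \<open>n \<in> \<S>\<^sub>y\<close> and
  dividing by \<open>x\<close> gives the renewal equation
  \<open>G + \<omega> * G = F + r\<close>, where \<open>G\<close>, \<open>F\<close> and \<open>r\<close> stand for \<open>\<Psi>(x,y)/x\<close>, \<open>\<lfloor>x\<rfloor>/x\<close> and
  \<open>R\<^sup>*(x,y)/x\<close> (\<open>Rstar_density_eq\<close>).

  The delay equations of Dickman and Buchstab say that \<open>\<rho>' + \<omega> + \<rho>' * \<omega> = 0\<close>
  (\<open>dickman'_buchstab_resolvent\<close>), i.e. that \<open>\<delta> + \<rho>'\<close> is the convolution inverse of \<open>\<delta> + \<omega>\<close>,
  where \<open>\<delta>\<close> is the unit mass at the origin. Hence \<open>G = (F + \<rho>' * F) + (r + \<rho>' * r)\<close>. The first bracket is \<open>\<Lambda>(x,y)/x\<close>, so that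
  \<open>\<Delta>(x,y)/x = r + \<rho>' * r\<close> (\<open>Delta_eq_Rstar_density\<close>).

  The bounds for \<open>R\<close> and \<open>R\<^sup>*\<close> follow termwise from those for \<open>Q\<close> and \<open>Q\<^sup>*\<close> and the Euler product
  \<open>\<Sum> 1/n = \<Pi>(y)\<^sup>-\<^sup>1\<close> over \<open>\<S>\<^sub>y\<close>. As \<open>\<rho>\<close> is nonnegative and nonincreasing from \<open>\<rho>(0) = 1\<close>, the mass of
  \<open>\<bar>\<rho>'\<bar>\<close> on \<open>[0,u]\<close> is \<open>1 - \<rho>(u)\<close>. Passing from \<open>r\<close> to \<open>r + \<rho>' * r\<close> thus at most doubles a
  bound. In the version with \<open>R\<close> one has \<open>R(x,y)/x = r + k\<close> with a constant \<open>k\<close>, which adds a term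
  \<open>- k (1 + \<integral> \<rho>') = - k \<rho>(u)\<close>. The hypothesis at \<open>x = 1\<close> bounds \<open>\<bar>k\<bar>\<close> by \<open>A = f(y) \<Pi>(y)\<^sup>-\<^sup>1\<close>, and
  \<open>A + A (1 - \<rho>(u)) + A \<rho>(u)\<close> is still \<open>2 A\<close> (\<open>dickman'_perturbation_bound\<close>).
\<close>

section \<open>Convolution of causal functions\<close>

text \<open>
  Causal functions vanish to the left of the origin and are bounded on every half-line to the left
  of a point. Convolutions of such functions are integrals of bounded functions over compact intervals, so
  they exist without any integrability condition at infinity and form a commutative algebra.
\<close>

definition causal :: "(real \<Rightarrow> real) \<Rightarrow> bool" where
  "causal f \<longleftrightarrow> f \<in> borel_measurable borel \<and> (\<forall>t<0. f t = 0) \<and>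
     (\<forall>T. \<exists>B. \<forall>t\<le>T. \<bar>f t\<bar> \<le> B)"

definition conv :: "(real \<Rightarrow> real) \<Rightarrow> (real \<Rightarrow> real) \<Rightarrow> real \<Rightarrow> real" where
  "conv f g u = (LINT t|lborel. f (u - t) * g t)"

lemma causalI:
  assumes "f \<in> borel_measurable borel" "\<And>t. t < 0 \<Longrightarrow> f t = 0"
    and "\<And>T. \<exists>B. \<forall>t\<le>T. \<bar>f t\<bar> \<le> B"
  shows "causal f"
  using assms by (auto simp: causal_def)

lemma causal_measurable: "causal f \<Longrightarrow> f \<in> borel_measurable borel"
  and causal_zero: "causal f \<Longrightarrow> t < 0 \<Longrightarrow> f t = 0"
  by (auto simp: causal_def)

lemma causal_bound:
  assumes "causal f"
  obtains B where "B \<ge> 0" "\<And>t. t \<le> T \<Longrightarrow> \<bar>f t\<bar> \<le> B"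
proof -
  obtain B where B: "\<forall>t\<le>T. \<bar>f t\<bar> \<le> B"
    using assms unfolding causal_def by blast
  moreover have "B \<ge> 0" using spec[OF B, of T] abs_ge_zero[of "f T"] by linarith
  ultimately show ?thesis using that by blast
qed

lemma causal_continuous_on:
  assumes "continuous_on {c..} f" "0 \<le> c" "\<And>t. t < c \<Longrightarrow> f t = 0"
  shows "causal f"
proof (rule causalI)
  have "(\<lambda>t. indicator {c..} t *\<^sub>R f t) = f"
    using assms by (auto simp: indicator_def fun_eq_iff)
  then show "f \<in> borel_measurable borel"
    using borel_measurable_continuous_on_indicator[of "{c..}" f] assms by simp
  show "f t = 0" if "t < 0" for t using assms that by auto
  fix T
  have "bounded (f ` {c..T})"
    by (intro compact_imp_bounded compact_continuous_image continuous_on_subset[OF assms(1)]) auto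
  then obtain B where B: "\<forall>t\<in>{c..T}. \<bar>f t\<bar> \<le> B"
    unfolding bounded_iff by auto
  have "\<forall>t\<le>T. \<bar>f t\<bar> \<le> max B 0"
  proof (intro allI impI)
    fix t assume "t \<le> T"
    then show "\<bar>f t\<bar> \<le> max B 0"
      using bspec[OF B, of t] assms(3)[of t] by (cases "t < c") auto
  qed
  then show "\<exists>B. \<forall>t\<le>T. \<bar>f t\<bar> \<le> B" by blast
qed

lemma causal_indicator: "0 \<le> a \<Longrightarrow> causal (indicator {a..})"
  by (rule causalI, measurable) (auto simp: indicator_def intro!: exI[where x = "1::real"])

lemma causal_linear:
  assumes f: "causal f" and g: "causal g"
  shows "causal (\<lambda>t. a * f t + b * g t)"
proof (rule causalI)
  note [measurable] = assms[THEN causal_measurable]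
  show "(\<lambda>t. a * f t + b * g t) \<in> borel_measurable borel" by measurable
  show "a * f t + b * g t = 0" if "t < 0" for t using assms that by (simp add: causal_zero)
  fix T
  obtain B where B: "B \<ge> 0" "\<And>t. t \<le> T \<Longrightarrow> \<bar>f t\<bar> \<le> B"
    using causal_bound[OF f, of T] by metis
  obtain C where C: "C \<ge> 0" "\<And>t. t \<le> T \<Longrightarrow> \<bar>g t\<bar> \<le> C"
    using causal_bound[OF g, of T] by metis
  have "\<bar>a * f t + b * g t\<bar> \<le> \<bar>a\<bar> * B + \<bar>b\<bar> * C" if "t \<le> T" for t
    using that B C by (intro order.trans[OF abs_triangle_ineq] add_mono)
      (auto simp: abs_mult intro!: mult_left_mono)
  then show "\<exists>B. \<forall>t\<le>T. \<bar>a * f t + b * g t\<bar> \<le> B" by blast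
qed

lemma causal_add: "causal f \<Longrightarrow> causal g \<Longrightarrow> causal (\<lambda>t. f t + g t)"
  using causal_linear[of f g 1 1] by simp

lemma causal_diff: "causal f \<Longrightarrow> causal g \<Longrightarrow> causal (\<lambda>t. f t - g t)"
  using causal_linear[of f g 1 "-1"] by simp

lemma causal_times_arg:
  assumes "causal f"
  shows "causal (\<lambda>t. t * f t)"
proof (rule causalI)
  note [measurable] = assms[THEN causal_measurable]
  show "(\<lambda>t. t * f t) \<in> borel_measurable borel" by measurable
  show "t * f t = 0" if "t < 0" for t using assms that by (simp add: causal_zero)
  fix T
  obtain B where B: "B \<ge> 0" "\<And>t. t \<le> T \<Longrightarrow> \<bar>f t\<bar> \<le> B"
    using causal_bound[OF assms] by metis
  have "\<bar>t * f t\<bar> \<le> \<bar>T\<bar> * B" if "t \<le> T" for t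
  proof (cases "t < 0")
    case True
    then show ?thesis using causal_zero[OF assms] B by simp
  next
    case False
    then show ?thesis using B that by (auto simp: abs_mult intro!: mult_mono)
  qed
  then show "\<exists>B. \<forall>t\<le>T. \<bar>t * f t\<bar> \<le> B" by blast
qed

lemma conv_integrand_support:
  assumes "causal f" "causal g" "t \<notin> {0..u}"
  shows "f (u - t) * g t = 0"
  using assms by (cases "t < 0") (auto simp: causal_zero)

lemma conv_integrable:
  assumes f: "causal f" and g: "causal g"
  shows "integrable lborel (\<lambda>t. f (u - t) * g t)"
proof -
  note [measurable] = f[THEN causal_measurable] g[THEN causal_measurable]
  obtain B where B: "B \<ge> 0" "\<And>t. t \<le> u \<Longrightarrow> \<bar>f t\<bar> \<le> B"
    using causal_bound[OF f, of u] by metis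
  obtain C where C: "C \<ge> 0" "\<And>t. t \<le> u \<Longrightarrow> \<bar>g t\<bar> \<le> C"
    using causal_bound[OF g, of u] by metis
  show ?thesis
  proof (rule integrableI_bounded_set[where A = "{0..u}" and B = "B * C"])
    show "(\<lambda>t. f (u - t) * g t) \<in> borel_measurable lborel" by measurable
    show "AE t in lborel. t \<in> {0..u} \<longrightarrow> norm (f (u - t) * g t) \<le> B * C"
      using B C by (auto simp: abs_mult intro!: AE_I2 mult_mono)
    show "AE t in lborel. t \<notin> {0..u} \<longrightarrow> f (u - t) * g t = 0"
      using conv_integrand_support[OF f g] by auto
    show "emeasure lborel {0..u} < \<infinity>" by (rule emeasure_bounded_finite) simp
  qed auto
qed

lemma conv_has_integral:
  assumes f: "causal f" and g: "causal g"
  shows "((\<lambda>t. f (u - t) * g t) has_integral conv f g u) {0..u}"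
proof -
  have "((\<lambda>t. f (u - t) * g t) has_integral conv f g u) UNIV"
    unfolding conv_def by (rule has_integral_integral_lborel[OF conv_integrable[OF f g]])
  moreover have "(\<lambda>t. f (u - t) * g t) = (\<lambda>t. if t \<in> {0..u} then f (u - t) * g t else 0)"
    using conv_integrand_support[OF f g] by (auto simp: fun_eq_iff)
  ultimately show ?thesis
    using has_integral_restrict_UNIV[of "{0..u}" "\<lambda>t. f (u - t) * g t"] by simp
qed

lemma conv_eq_integral:
  "causal f \<Longrightarrow> causal g \<Longrightarrow> conv f g u = integral {0..u} (\<lambda>t. f (u - t) * g t)"
  by (rule integral_unique[symmetric, OF conv_has_integral])

lemma conv_zero:
  assumes "causal f" "causal g" "u \<le> 0"
  shows "conv f g u = 0"
proof -
  have "negligible {0..u}" using \<open>u \<le> 0\<close> by (cases "u = 0") auto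
  then have "((\<lambda>t. f (u - t) * g t) has_integral 0) {0..u}"
    by (rule has_integral_negligible) auto
  then show ?thesis by (rule has_integral_unique[OF conv_has_integral[OF assms(1,2)]])
qed

lemma causal_conv:
  assumes f: "causal f" and g: "causal g"
  shows "causal (conv f g)"
proof (rule causalI)
  note [measurable] = f[THEN causal_measurable] g[THEN causal_measurable]
  have "(\<lambda>u. LINT t|lborel. f (u - t) * g t) \<in> borel_measurable borel" by measurable
  then show "conv f g \<in> borel_measurable borel" unfolding conv_def[abs_def] .
  show "conv f g t = 0" if "t < 0" for t using conv_zero[OF f g, of t] that by simp
  fix T
  obtain B where B: "B \<ge> 0" "\<And>t. t \<le> T \<Longrightarrow> \<bar>f t\<bar> \<le> B"
    using causal_bound[OF f, of T] by metis
  obtain C where C: "C \<ge> 0" "\<And>t. t \<le> T \<Longrightarrow> \<bar>g t\<bar> \<le> C"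
    using causal_bound[OF g, of T] by metis
  have "\<bar>conv f g u\<bar> \<le> B * C * \<bar>T\<bar>" if "u \<le> T" for u
  proof (cases "u \<le> 0")
    case True
    then show ?thesis using conv_zero[OF f g True] B C by simp
  next
    case False
    have "norm (conv f g u) \<le> B * C * measure lborel (cbox 0 u)"
      by (rule has_integral_bound[OF _ conv_has_integral[OF f g, of u, folded cbox_interval]])
        (use B C that in \<open>auto simp: abs_mult intro!: mult_mono\<close>)
    also have "\<dots> \<le> B * C * \<bar>T\<bar>" using B C False that by (auto intro!: mult_left_mono)
    finally show ?thesis by simp
  qed
  then show "\<exists>B. \<forall>t\<le>T. \<bar>conv f g t\<bar> \<le> B" by blast
qed

lemma conv_commute: "conv f g = conv g f"
proof
  fix u
  have "conv f g u = (LINT t|lborel. f (u - (u + (-1) * t)) * g (u + (-1) * t))"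
    unfolding conv_def by (subst lborel_integral_real_affine[of "-1" _ u]) auto
  then show "conv f g u = conv g f u" by (simp add: conv_def mult.commute)
qed

lemma conv_add_left:
  assumes "causal f" "causal g" "causal h"
  shows "conv (\<lambda>t. f t + g t) h u = conv f h u + conv g h u"
  using Bochner_Integration.integral_add[OF conv_integrable[OF assms(1,3), of u]
      conv_integrable[OF assms(2,3), of u]]
  by (simp add: conv_def distrib_right)

lemma conv_minus_left: "conv (\<lambda>t. - f t) h u = - conv f h u"
  unfolding conv_def by simp

text \<open>Multiplication by the argument is a derivation, because \<open>u = (u - t) + t\<close>.\<close>

lemma conv_times_arg:
  assumes "causal f" "causal g"
  shows "u * conv f g u = conv (\<lambda>t. t * f t) g u + conv f (\<lambda>t. t * g t) u"
proof -
  have "conv (\<lambda>t. t * f t) g u + conv f (\<lambda>t. t * g t) u =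
      (LINT t|lborel. (u - t) * f (u - t) * g t + f (u - t) * (t * g t))"
    unfolding conv_def
    using conv_integrable[OF causal_times_arg[OF assms(1)] assms(2)]
      conv_integrable[OF assms(1) causal_times_arg[OF assms(2)]]
    by (subst Bochner_Integration.integral_add) auto
  also have "\<dots> = (LINT t|lborel. u * (f (u - t) * g t))"
    by (rule Bochner_Integration.integral_cong) (auto simp: algebra_simps)
  finally show ?thesis by (simp add: conv_def)
qed

text \<open>
  Fubini's theorem for the kernel \<open>f(u - v) g(v - t) h(t)\<close>, which is bounded and supported on
  \<open>0 \<le> t \<le> v \<le> u\<close>.
\<close>

lemma conv_assoc:
  assumes f: "causal f" and g: "causal g" and h: "causal h"
  shows "conv (conv f g) h = conv f (conv g h)"
proof
  fix u
  note [measurable] = f[THEN causal_measurable] g[THEN causal_measurable] h[THEN causal_measurable]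
  define K where "K t v = f (u - v) * g (v - t) * h t" for t v
  obtain B where B: "B \<ge> 0" "\<And>t. t \<le> u \<Longrightarrow> \<bar>f t\<bar> \<le> B"
    using causal_bound[OF f, of u] by metis
  obtain C where C: "C \<ge> 0" "\<And>t. t \<le> u \<Longrightarrow> \<bar>g t\<bar> \<le> C"
    using causal_bound[OF g, of u] by metis
  obtain D where D: "D \<ge> 0" "\<And>t. t \<le> u \<Longrightarrow> \<bar>h t\<bar> \<le> D"
    using causal_bound[OF h, of u] by metis
  have supp: "K t v = 0" if "\<not> (0 \<le> t \<and> t \<le> v \<and> v \<le> u)" for t v
    using that f g h by (auto simp: K_def causal_zero not_le)
  have K: "integrable (lborel \<Otimes>\<^sub>M lborel) (case_prod K)"
  proof (rule integrableI_bounded_set[where A = "{0..u} \<times> {0..u}" and B = "B * C * D"])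
    show "case_prod K \<in> borel_measurable (lborel \<Otimes>\<^sub>M lborel)" unfolding K_def by measurable
    have "emeasure (lborel \<Otimes>\<^sub>M lborel) ({0..u} \<times> {0..u}) =
        emeasure lborel {0..u} * emeasure lborel {0..u}"
      by (intro lborel.emeasure_pair_measure_Times) auto
    also have "\<dots> < \<infinity>"
      using emeasure_bounded_finite[of "{0..u}"] by (simp add: ennreal_mult_less_top)
    finally show "emeasure (lborel \<Otimes>\<^sub>M lborel) ({0..u} \<times> {0..u}) < \<infinity>" .
    have "\<bar>K t v\<bar> \<le> B * C * D" for t v
    proof (cases "0 \<le> t \<and> t \<le> v \<and> v \<le> u")
      case True
      then show ?thesis unfolding K_def abs_mult
        using B C D by (intro mult_mono) auto
    qed (use B C D supp in auto)
    then show "AE z in lborel \<Otimes>\<^sub>M lborel. z \<in> {0..u} \<times> {0..u} \<longrightarrow> norm (case_prod K z) \<le> B * C * D"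
      by auto
    show "AE z in lborel \<Otimes>\<^sub>M lborel. z \<notin> {0..u} \<times> {0..u} \<longrightarrow> case_prod K z = 0"
      using supp by (intro AE_I2) (auto split: prod.splits)
  qed auto
  have "conv (conv f g) h u = (LINT t|lborel. LINT v|lborel. K t v)"
    unfolding conv_def
  proof (rule Bochner_Integration.integral_cong[OF refl])
    fix t
    have "(LINT s|lborel. f (u - t - s) * g s) = (LINT v|lborel. f (u - t - (- t + v)) * g (- t + v))"
      by (subst lborel_integral_real_affine[of 1 _ "-t"]) auto
    then show "(LINT s|lborel. f (u - t - s) * g s) * h t = (LINT v|lborel. K t v)"
      by (simp add: K_def)
  qed
  also have "\<dots> = (LINT v|lborel. LINT t|lborel. K t v)"
    by (rule lborel_pair.Fubini_integral[OF K, symmetric])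
  also have "\<dots> = conv f (conv g h) u"
    unfolding conv_def K_def by (simp add: mult.assoc)
  finally show "conv (conv f g) h u = conv f (conv g h) u" .
qed

lemma conv_step:
  assumes f: "causal f" and "0 \<le> a"
  shows "(f has_integral conv (indicator {a..}) f u) {0..u - a}"
proof -
  have 1: "((\<lambda>t. indicator {a..} (u - t) * f t) has_integral conv (indicator {a..}) f u) {0..u}"
    by (rule conv_has_integral[OF causal_indicator[OF \<open>0 \<le> a\<close>] f])
  have "(\<lambda>t. indicator {a..} (u - t) * f t) = (\<lambda>t. if t \<in> {..u - a} then f t else 0)"
    by (auto simp: indicator_def)
  then have "(f has_integral conv (indicator {a..}) f u) ({0..u} \<inter> {..u - a})"
    using 1 has_integral_restrict_Int[of "{..u - a}" f _ "{0..u}"] by (simp add: Int_commute)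
  also have "{0..u} \<inter> {..u - a} = {0..u - a}" using \<open>0 \<le> a\<close> by auto
  finally show ?thesis .
qed

lemma conv_shift_right: "conv f (\<lambda>t. g (t - a)) u = conv f g (u - a)"
  using lborel_integral_real_affine[of 1 "\<lambda>t. f (u - t) * g (t - a)" a]
  by (simp add: conv_def diff_diff_eq)

lemma conv_step_shift: "conv (indicator {a..}) f u = conv (indicator {0..}) f (u - a)"
proof -
  have "indicator {a..} = (\<lambda>t. indicator {0..} (t - a) :: real)"
    by (auto simp: indicator_def fun_eq_iff)
  then have "conv f (indicator {a..}) u = conv f (indicator {0..}) (u - a)"
    using conv_shift_right[of f "indicator {0..}" a u] by simp
  then show ?thesis by (simp add: conv_commute)
qed

lemma causal_shift:
  assumes f: "causal f" and a: "0 \<le> a"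
  shows "causal (\<lambda>t. f (t - a))"
proof (rule causalI)
  note [measurable] = f[THEN causal_measurable]
  show "(\<lambda>t. f (t - a)) \<in> borel_measurable borel" by measurable
  show "f (t - a) = 0" if "t < 0" for t using that a by (simp add: causal_zero[OF f])
  fix T
  obtain B where "\<And>t. t \<le> T - a \<Longrightarrow> \<bar>f t\<bar> \<le> B" using causal_bound[OF f, of "T - a"] by metis
  then have "\<forall>t\<le>T. \<bar>f (t - a)\<bar> \<le> B" by simp
  then show "\<exists>B. \<forall>t\<le>T. \<bar>f (t - a)\<bar> \<le> B" by blast
qed

lemma conv_cong_right:
  assumes f: "causal f" and eq: "\<And>t. t \<le> u \<Longrightarrow> g t = h t"
  shows "conv f g u = conv f h u"
  unfolding conv_def
proof (rule Bochner_Integration.integral_cong[OF refl])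
  fix t
  show "f (u - t) * g t = f (u - t) * h t"
    using eq[of t] causal_zero[OF f, of "u - t"] by (cases "t \<le> u") auto
qed

lemma conv_sum_right:
  assumes f: "causal f" and g: "\<And>n. n \<in> T \<Longrightarrow> causal (g n)"
  shows "conv f (\<lambda>t. \<Sum>n\<in>T. c n * g n t) u = (\<Sum>n\<in>T. c n * conv f (g n) u)"
proof -
  have "conv f (\<lambda>t. \<Sum>n\<in>T. c n * g n t) u =
      (LINT t|lborel. (\<Sum>n\<in>T. c n * (f (u - t) * g n t)))"
    unfolding conv_def
    by (rule Bochner_Integration.integral_cong[OF refl]) (simp add: sum_distrib_left mult_ac)
  also have "\<dots> = (\<Sum>n\<in>T. LINT t|lborel. c n * (f (u - t) * g n t))"
    using conv_integrable[OF f g] by (intro Bochner_Integration.integral_sum) auto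
  finally show ?thesis by (simp add: conv_def)
qed

section \<open>Dickman's and Buchstab's functions as convolution inverses\<close>

lemma dickman_neg: "u < 0 \<Longrightarrow> dickman u = 0"
  and dickman_unit: "0 \<le> u \<Longrightarrow> u \<le> 1 \<Longrightarrow> dickman u = 1"
  and dickman_continuous: "continuous_on {0..} dickman"
  using is_dickman_dickman by (auto simp: is_dickman_def)

lemma buchstab_lt_1: "u < 1 \<Longrightarrow> buchstab u = 0"
  and buchstab_1_2: "1 \<le> u \<Longrightarrow> u \<le> 2 \<Longrightarrow> buchstab u = 1 / u"
  and buchstab_continuous: "continuous_on {1..} buchstab"
  and buchstab_deriv: "u > 2 \<Longrightarrow> ((\<lambda>t. t * buchstab t) has_real_derivative buchstab (u - 1)) (at u)"
  using is_buchstab_buchstab by (auto simp: is_buchstab_def)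

lemma dickman_has_derivative_dickman':
  assumes "u \<noteq> 0" "u \<noteq> 1"
  shows "(dickman has_real_derivative dickman' u) (at u)"
    and "dickman' u = (if u < 1 then 0 else - dickman (u - 1) / u)"
proof -
  have "(dickman has_real_derivative (if u < 1 then 0 else - dickman (u - 1) / u)) (at u)"
  proof -
    consider "u < 0" | "0 < u" "u < 1" | "u > 1" using assms by linarith
    then show ?thesis
    proof cases
      case 1
      have "(dickman has_real_derivative 0) (at u)"
        by (rule has_field_derivative_transform_within_open[of "\<lambda>_. 0" _ _ "{..<0}"])
          (use 1 in \<open>auto simp: dickman_neg\<close>)
      then show ?thesis using 1 by simp
    next
      case 2
      have "(dickman has_real_derivative 0) (at u)"
        by (rule has_field_derivative_transform_within_open[of "\<lambda>_. 1" _ _ "{0<..<1}"])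
          (use 2 in \<open>auto simp: dickman_unit\<close>)
      then show ?thesis using 2 by simp
    next
      case 3
      have "delay_solution 1 (\<lambda>u. - 1 / u) dickman"
        using is_dickman_dickman by (simp add: is_dickman_iff)
      then have "(dickman has_real_derivative - 1 / u * dickman (u - 1)) (at u)"
        unfolding delay_solution_def using 3 by blast
      then show ?thesis using 3 by simp
    qed
  qed
  moreover from this have "deriv dickman u = (if u < 1 then 0 else - dickman (u - 1) / u)"
    by (rule DERIV_imp_deriv)
  ultimately show "(dickman has_real_derivative dickman' u) (at u)"
    and "dickman' u = (if u < 1 then 0 else - dickman (u - 1) / u)"
    using assms by (auto simp: dickman'_def)
qed

text \<open>
  The formula covers the corners \<open>0\<close> and \<open>1\<close> as well, so the delay equation
  \<open>u \<rho>'(u) = - \<rho>(u - 1)\<close> holds on the whole line.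
\<close>

lemma dickman'_lt_1: "u < 1 \<Longrightarrow> dickman' u = 0"
  and dickman'_ge_1: "1 \<le> u \<Longrightarrow> dickman' u = - dickman (u - 1) / u"
  using dickman_has_derivative_dickman'(2)[of u]
  by (cases "u = 0"; cases "u = 1"; simp add: dickman'_0 dickman'_1 dickman_unit)+

lemma causal_dickman: "causal dickman"
  by (rule causal_continuous_on[OF dickman_continuous]) (auto simp: dickman_neg)

lemma causal_dickman': "causal dickman'"
proof (rule causal_continuous_on[of 1])
  have "continuous_on {1..} (\<lambda>u. - dickman (u - 1) / u)"
    by (intro continuous_intros continuous_on_compose2[OF dickman_continuous]) auto
  then show "continuous_on {1..} dickman'"
    by (rule continuous_on_eq) (auto simp: dickman'_ge_1)
qed (auto simp: dickman'_lt_1)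

lemma causal_buchstab: "causal buchstab"
  by (rule causal_continuous_on[OF buchstab_continuous]) (auto simp: buchstab_lt_1)

lemma dickman'_has_integral:
  assumes "0 \<le> a" "a \<le> b"
  shows "(dickman' has_integral dickman b - dickman a) {a..b}"
proof (rule fundamental_theorem_of_calculus_interior_strong[of "{1}"])
  show "continuous_on {a..b} dickman"
    by (rule continuous_on_subset[OF dickman_continuous]) (use assms in auto)
  show "(dickman has_vector_derivative dickman' x) (at x)" if "x \<in> {a<..<b} - {1}" for x
    using dickman_has_derivative_dickman'(1)[of x] that assms
    by (simp add: has_real_derivative_iff_has_vector_derivative)
qed (use assms in auto)

text \<open>
  The argument is \<open>s + 1\<close> rather than \<open>s\<close> because \<open>\<omega>\<close> jumps at \<open>1\<close>: integration of
  \<open>(t \<omega>(t))' = \<omega>(t - 1)\<close> has to start there. The corner of \<open>t \<omega>(t)\<close> at \<open>2\<close> is a single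
  exceptional point, harmless for a continuous primitive.
\<close>

lemma buchstab_has_integral:
  assumes "0 \<le> s"
  shows "(buchstab has_integral (s + 1) * buchstab (s + 1) - 1) {0..s}"
proof -
  have "(buchstab has_integral (s + 1) * buchstab (s + 1) - (0 + 1) * buchstab (0 + 1)) {0..s}"
  proof (rule fundamental_theorem_of_calculus_interior_strong[of "{1}"])
    show "continuous_on {0..s} (\<lambda>t. (t + 1) * buchstab (t + 1))"
      by (intro continuous_intros continuous_on_compose2[OF buchstab_continuous]) auto
    show "((\<lambda>t. (t + 1) * buchstab (t + 1)) has_vector_derivative buchstab x) (at x)"
      if x: "x \<in> {0<..<s} - {1}" for x
    proof (cases "x < 1")
      case True
      have "((\<lambda>t. (t + 1) * buchstab (t + 1)) has_real_derivative 0) (at x)"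
        by (rule has_field_derivative_transform_within_open[of "\<lambda>_. 1" _ _ "{0<..<1}"])
          (use x True in \<open>auto simp: buchstab_1_2\<close>)
      then show ?thesis
        using True by (simp add: buchstab_lt_1 has_real_derivative_iff_has_vector_derivative)
    next
      case False
      then show ?thesis
        using buchstab_deriv[of "x + 1"] x DERIV_shift[of "\<lambda>t. t * buchstab t" "buchstab x" x 1]
        by (simp add: has_real_derivative_iff_has_vector_derivative)
    qed
  qed (use assms in auto)
  then show ?thesis by (simp add: buchstab_1_2)
qed

lemma conv_heaviside_dickman':
  "conv (indicator {0..}) dickman' u = dickman u - indicator {0..} u"
proof (cases "u < 0")
  case True
  then show ?thesis
    using conv_zero[OF causal_indicator[OF order.refl] causal_dickman', of u]
    by (simp add: dickman_neg)
next
  case False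
  have "(dickman' has_integral conv (indicator {0..}) dickman' u) {0..u}"
    using conv_step[OF causal_dickman', of 0 u] by simp
  then show ?thesis
    using False has_integral_unique[OF _ dickman'_has_integral[of 0 u]] by (simp add: dickman_unit)
qed

lemma times_dickman': "u * dickman' u = - dickman (u - 1)"
  by (cases "u < 1") (auto simp: dickman'_lt_1 dickman'_ge_1 dickman_neg)

lemma times_buchstab:
  "u * buchstab u = indicator {1..} u + conv (indicator {1..}) buchstab u"
proof (cases "u < 1")
  case True
  then show ?thesis
    using conv_zero[OF causal_indicator[OF order.refl] causal_buchstab, of "u - 1"]
    by (simp add: buchstab_lt_1 conv_step_shift[of 1])
next
  case False
  have "(buchstab has_integral conv (indicator {1..}) buchstab u) {0..u-1}"
    by (rule conv_step[OF causal_buchstab]) simp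
  moreover have "(buchstab has_integral u * buchstab u - 1) {0..u-1}"
    using buchstab_has_integral[of "u - 1"] False by simp
  ultimately have "conv (indicator {1..}) buchstab u = u * buchstab u - 1"
    by (rule has_integral_unique)
  then show ?thesis using False by simp
qed

text \<open>
  This says that \<open>\<delta> + \<rho>'\<close> and \<open>\<delta> + \<omega>\<close> are inverse to each other. Multiplication by \<open>u\<close> is a
  derivation of the convolution algebra, and with \<open>J = 1\<^sub>[\<^sub>1\<^sub>,\<^sub>\<infinity>\<^sub>)\<close> the two delay equations
  read \<open>u \<rho>' = - (J + J * \<rho>')\<close> and \<open>u \<omega> = J + J * \<omega>\<close>. Hence \<open>u\<close> times the left side of
  the identity cancels completely.
\<close>

lemma dickman'_buchstab_resolvent:
  "dickman' u + buchstab u + conv dickman' buchstab u = 0"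
proof (cases "u = 0")
  case True
  then show ?thesis
    using conv_zero[OF causal_dickman' causal_buchstab, of u]
    by (simp add: dickman'_lt_1 buchstab_lt_1)
next
  case False
  define J :: "real \<Rightarrow> real" where "J = indicator {1..}"
  note c = causal_dickman' causal_buchstab
  have J: "causal J" unfolding J_def by (rule causal_indicator) simp
  have s: "t * dickman' t = - (J t + conv J dickman' t)" for t
    using conv_heaviside_dickman'[of "t - 1"]
    by (simp add: times_dickman' J_def conv_step_shift[of 1] indicator_def)
  have b: "t * buchstab t = J t + conv J buchstab t" for t
    by (simp add: times_buchstab J_def)
  have "conv (\<lambda>t. t * dickman' t) buchstab u =
      - (conv J buchstab u + conv (conv J dickman') buchstab u)"
    unfolding s conv_minus_left using conv_add_left[OF J causal_conv[OF J c(1)] c(2)] by simp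
  moreover have "conv dickman' (\<lambda>t. t * buchstab t) u =
      conv J dickman' u + conv (conv J dickman') buchstab u"
  proof -
    have "conv dickman' (\<lambda>t. t * buchstab t) u = conv (\<lambda>t. J t + conv J buchstab t) dickman' u"
      unfolding b by (simp add: conv_commute)
    also have "\<dots> = conv J dickman' u + conv (conv J buchstab) dickman' u"
      by (rule conv_add_left[OF J causal_conv[OF J c(2)] c(1)])
    also have "conv (conv J buchstab) dickman' = conv (conv J dickman') buchstab"
      by (simp add: conv_assoc J c conv_commute[of buchstab])
    finally show ?thesis .
  qed
  ultimately have "u * conv dickman' buchstab u = conv J dickman' u - conv J buchstab u"
    using conv_times_arg[OF c, of u] by simp
  then have "u * (dickman' u + buchstab u + conv dickman' buchstab u) = 0"
    using s[of u] b[of u] by (simp add: distrib_left)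
  then show ?thesis using False by simp
qed

text \<open>
  Convolving the equation with \<open>\<rho>'\<close> and replacing \<open>\<rho>' * \<omega>\<close> by \<open>- \<rho>' - \<omega>\<close> yields
  \<open>\<rho>' * E = - \<omega> * G\<close>.
\<close>

lemma buchstab_equation_inversion:
  assumes G: "causal G" and eq: "\<And>u. G u + conv buchstab G u = E u"
  shows "G u = E u + conv dickman' E u"
proof -
  note c = causal_dickman' causal_buchstab
  have E: "E = (\<lambda>t. G t + conv buchstab G t)" by (rule ext) (rule eq[symmetric])
  have "conv dickman' E u = conv (\<lambda>t. G t + conv buchstab G t) dickman' u"
    unfolding E by (rule fun_cong[OF conv_commute])
  also have "\<dots> = conv G dickman' u + conv (conv buchstab G) dickman' u"
    by (rule conv_add_left[OF G causal_conv[OF c(2) G] c(1)])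
  also have "\<dots> = conv dickman' G u + conv (conv dickman' buchstab) G u"
    by (simp add: conv_assoc G c conv_commute[of G dickman'] conv_commute[of "conv buchstab G"])
  also have "conv dickman' buchstab = (\<lambda>t. - (dickman' t + buchstab t))"
    using dickman'_buchstab_resolvent by (auto simp: fun_eq_iff add_eq_0_iff)
  also have "conv (\<lambda>t. - (dickman' t + buchstab t)) G u = - (conv dickman' G u + conv buchstab G u)"
    unfolding conv_minus_left by (simp add: conv_add_left c G)
  finally show ?thesis using eq[of u] by simp
qed

text \<open>
  Nonnegativity of \<open>\<rho>\<close> rests on the averaging form \<open>u \<rho>(u) = \<integral> \<rho>\<close> over \<open>[u - 1, u]\<close> of the delay
  equation. It follows from \<open>\<rho> = H + H * \<rho>'\<close>, where \<open>H = 1\<^sub>[\<^sub>0\<^sub>,\<^sub>\<infinity>\<^sub>)\<close>, by the same derivation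
  rule together with \<open>u H = H * H\<close>.
\<close>

lemma times_dickman:
  "u * dickman u = conv (indicator {0..}) dickman u - conv (indicator {0..}) dickman (u - 1)"
proof -
  define H :: "real \<Rightarrow> real" where "H = indicator {0..}"
  have H: "causal H" unfolding H_def by (rule causal_indicator) simp
  note c = causal_dickman'
  have HH: "t * H t = conv H H t" for t
  proof (cases "t < 0")
    case True
    then show ?thesis using conv_zero[OF H H, of t] causal_zero[OF H True] by simp
  next
    case False
    have "(H has_integral conv H H t) {0..t}"
      using conv_step[OF H, of 0 t] by (simp add: H_def)
    moreover have "(H has_integral t) {0..t}"
    proof (rule has_integral_eq[rotated])
      show "((\<lambda>_. 1) has_integral t) {0..t}"
        using has_integral_const_real[of "1::real" 0 t] False by simp
    qed (auto simp: H_def)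
    ultimately have "conv H H t = t" by (rule has_integral_unique)
    then show ?thesis using False by (simp add: H_def)
  qed
  have d: "dickman = (\<lambda>t. H t + conv H dickman' t)"
    using conv_heaviside_dickman' by (auto simp: H_def)
  have "u * conv H dickman' u = conv (conv H H) dickman' u + conv H (\<lambda>t. - dickman (t - 1)) u"
    using conv_times_arg[OF H c, of u] by (simp add: HH times_dickman')
  also have "conv H (\<lambda>t. - dickman (t - 1)) u = - conv H dickman (u - 1)"
    using conv_minus_left[of "\<lambda>t. dickman (t - 1)" H u] conv_shift_right[of H dickman 1 u]
    by (simp add: conv_commute)
  also have "conv (conv H H) dickman' u = conv H (conv H dickman') u"
    by (simp add: conv_assoc H c)
  finally have "u * (H u + conv H dickman' u) =
      conv H H u + conv H (conv H dickman') u - conv H dickman (u - 1)"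
    by (simp add: distrib_left HH)
  also have "conv H H u + conv H (conv H dickman') u = conv H dickman u"
    using conv_add_left[OF H causal_conv[OF H c] H, of u] d by (simp add: conv_commute)
  finally show ?thesis using d by (metis H_def)
qed

lemma dickman_average:
  assumes "1 \<le> u"
  shows "(dickman has_integral u * dickman u) {u-1..u}"
proof -
  have i: "(dickman has_integral conv (indicator {0..}) dickman t) {0..t}" for t
    using conv_step[OF causal_dickman, of 0 t] by simp
  have "integral {0..u-1} dickman + integral {u-1..u} dickman = integral {0..u} dickman"
    using assms by (intro Henstock_Kurzweil_Integration.integral_combine)
      (auto intro: has_integral_integrable[OF i])
  moreover have "dickman integrable_on {u-1..u}"
    by (rule integrable_on_subinterval[OF has_integral_integrable[OF i[of u]]]) (use assms in auto)
  ultimately show ?thesis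
    using times_dickman[of u] integral_unique[OF i] by (simp add: has_integral_integrable_integral)
qed

text \<open>
  If \<open>\<rho> \<ge> 0\<close> up to \<open>u - 1\<close>, then \<open>\<rho>\<close> is nonincreasing on \<open>[0, u]\<close>, so its average over \<open>[u - 1, u]\<close> is at
  least \<open>\<rho>(u)\<close>. But the integral is \<open>u \<rho>(u)\<close>, whence \<open>\<rho>(u) \<le> u \<rho>(u)\<close>, which for \<open>u > 1\<close>
  forces \<open>\<rho>(u) \<ge> 0\<close>.
\<close>

lemma dickman_nonneg: "0 \<le> dickman u"
proof -
  have "0 \<le> dickman u" if "u \<le> real n + 1" for n
    using that
  proof (induction n arbitrary: u)
    case 0
    then show ?case by (cases "u < 0") (auto simp: dickman_neg dickman_unit)
  next
    case (Suc n)
    show ?case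
    proof (cases "u \<le> real n + 1")
      case True
      then show ?thesis by (rule Suc.IH)
    next
      case False
      then have u: "1 < u" by linarith
      have "dickman u \<le> dickman t" if t: "t \<in> {u-1..u}" for t
      proof -
        have "(dickman' has_integral dickman u - dickman t) {t..u}"
          using t u by (intro dickman'_has_integral) auto
        moreover have "dickman' s \<le> 0" if "s \<in> {t..u}" for s
          using Suc.IH[of "s - 1"] Suc.prems that
          by (cases "s < 1") (auto simp: dickman'_lt_1 dickman'_ge_1)
        ultimately have "dickman u - dickman t \<le> 0" 
          by (rule has_integral_le[OF _ has_integral_0])
        then show ?thesis by simp
      qed
      then have "1 * dickman u \<le> u * dickman u"
        using has_integral_const_real[of "dickman u" "u - 1" u] u
        by (intro has_integral_le[OF _ dickman_average[of u]]) auto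
      then have "0 \<le> (u - 1) * dickman u" by (simp add: algebra_simps)
      then show ?thesis using u by (simp add: zero_le_mult_iff)
    qed
  qed
  moreover have "u \<le> real (nat \<lceil>u\<rceil>) + 1" by linarith
  ultimately show ?thesis by blast
qed

lemma dickman'_nonpos: "dickman' u \<le> 0"
  using dickman_nonneg by (cases "u < 1") (auto simp: dickman'_lt_1 dickman'_ge_1)

text \<open>
  As \<open>\<rho>' \<le> 0\<close>, the mass of \<open>\<bar>\<rho>'\<bar>\<close> on \<open>[0, u]\<close> is \<open>1 - \<rho>(u)\<close>. Write the quantity to be bounded as
  \<open>(r + k)(u) + (\<rho>' * (r + k))(u) - k \<rho>(u)\<close>; the three terms are at most \<open>A\<close>,
  \<open>A (1 - \<rho>(u))\<close> and \<open>A \<rho>(u)\<close>, so a constant perturbation \<open>k\<close> of size \<open>A\<close> costs nothing.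
\<close>

lemma dickman'_perturbation_bound:
  assumes r: "causal r" and u: "0 \<le> u" and k: "\<bar>k\<bar> \<le> A"
    and bound: "\<And>v. 0 \<le> v \<Longrightarrow> v \<le> u \<Longrightarrow> \<bar>r v + k\<bar> \<le> A"
  shows "\<bar>r u + conv dickman' r u\<bar> \<le> 2 * A"
proof -
  have d: "(dickman' has_integral dickman u - 1) {0..u}"
    using dickman'_has_integral[of 0 u] u by (simp add: dickman_unit)
  have i: "((\<lambda>t. r (u - t) * dickman' t + k * dickman' t) has_integral
      conv dickman' r u + k * (dickman u - 1)) {0..u}"
    using has_integral_add[OF conv_has_integral[OF r causal_dickman', of u]
        has_integral_mult_right[OF d, of k]]
    by (simp add: conv_commute[of r])
  have j: "((\<lambda>t. - A * dickman' t) has_integral - A * (dickman u - 1)) {0..u}"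
    by (rule has_integral_mult_right[OF d])
  have "\<bar>conv dickman' r u + k * (dickman u - 1)\<bar> \<le> - A * (dickman u - 1)"
    unfolding integral_unique[OF i, symmetric] integral_unique[OF j, symmetric] real_norm_def[symmetric]
  proof (rule integral_norm_bound_integral[OF has_integral_integrable[OF i] has_integral_integrable[OF j]])
    fix t assume t: "t \<in> {0..u}"
    have "norm (r (u - t) * dickman' t + k * dickman' t) = \<bar>r (u - t) + k\<bar> * - dickman' t"
      using dickman'_nonpos[of t] by (simp add: abs_mult flip: distrib_right)
    also have "\<dots> \<le> A * - dickman' t"
      using bound[of "u - t"] t dickman'_nonpos[of t] by (intro mult_right_mono) auto
    finally show "norm (r (u - t) * dickman' t + k * dickman' t) \<le> - A * dickman' t" by simp
  qed
  moreover have "\<bar>r u + k\<bar> \<le> A" using bound[of u] u by simp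
  moreover have "\<bar>k * dickman u\<bar> \<le> A * dickman u"
    using k dickman_nonneg[of u] by (simp add: abs_mult mult_right_mono)
  ultimately show ?thesis by (simp add: algebra_simps)
qed

section \<open>Integers with prescribed prime factors\<close>

definition numbers_over :: "nat set \<Rightarrow> nat set" where
  "numbers_over A = {n. n > 0 \<and> (\<forall>p. prime p \<and> p dvd n \<longrightarrow> p \<in> A)}"

lemma smooth_numbers_eq: "smooth_numbers y = numbers_over {p. prime p \<and> real p \<le> y}"
  by (auto simp: smooth_numbers_def numbers_over_def)

lemma Phi_eq: "Phi x y = card {n \<in> numbers_over {p. prime p \<and> y < real p}. real n \<le> x}"
  unfolding Phi_def numbers_over_def by (rule arg_cong[of _ _ card]) auto

text \<open>
  Unique factorization: split the prime factors of an integer according to the set they lie in.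
  With the primes up to \<open>y\<close> and those beyond, this pairs smooth with rough numbers; with \<open>B\<close>
  a single prime, it is the induction step for the Euler product.
\<close>

lemma bij_betw_mult_numbers_over:
  assumes AB: "A \<inter> B = {}"
  shows "bij_betw (\<lambda>(n, k). n * k) (numbers_over A \<times> numbers_over B) (numbers_over (A \<union> B))"
proof (rule bij_betw_imageI)
  have cop: "coprime n k" if "n \<in> numbers_over A" "k \<in> numbers_over B" for n k
  proof (rule ccontr)
    assume "\<not> coprime n k"
    then obtain p where "prime p" "p dvd n" "p dvd k"
      using prime_factor_nat[of "gcd n k"] by (auto simp: coprime_iff_gcd_eq_1)
    then show False using that AB by (auto simp: numbers_over_def)
  qed
  show "inj_on (\<lambda>(n, k). n * k) (numbers_over A \<times> numbers_over B)"
  proof (rule inj_onI, clarify)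
    fix n k n' k'
    assume m: "n \<in> numbers_over A" "k \<in> numbers_over B" "n' \<in> numbers_over A" "k' \<in> numbers_over B"
      and eq: "n * k = n' * k'"
    have "n dvd n'"
      using cop[OF m(1,4)] eq by (metis coprime_dvd_mult_left_iff dvd_triv_left)
    moreover have "n' dvd n"
      using cop[OF m(3,2)] eq by (metis coprime_dvd_mult_left_iff dvd_triv_left)
    ultimately have "n = n'" by (rule dvd_antisym)
    then show "n = n' \<and> k = k'" using eq m(1) by (auto simp: numbers_over_def)
  qed
  show "(\<lambda>(n, k). n * k) ` (numbers_over A \<times> numbers_over B) = numbers_over (A \<union> B)"
  proof (intro equalityI subsetI)
    fix m assume "m \<in> (\<lambda>(n, k). n * k) ` (numbers_over A \<times> numbers_over B)"
    then show "m \<in> numbers_over (A \<union> B)"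
      by (auto simp: numbers_over_def dest: prime_dvd_multD)
  next
    fix m assume m: "m \<in> numbers_over (A \<union> B)"
    define M where "M = prime_factorization m"
    define n k where "n = prod_mset {#p \<in># M. p \<in> A#}" and "k = prod_mset {#p \<in># M. p \<notin> A#}"
    have "m > 0" using m by (simp add: numbers_over_def)
    have "n * k = prod_mset ({#p \<in># M. p \<in> A#} + {#p \<in># M. p \<notin> A#})"
      unfolding n_def k_def by (rule prod_mset.union[symmetric])
    also have "{#p \<in># M. p \<in> A#} + {#p \<in># M. p \<notin> A#} = M"
      by (rule multiset_partition[symmetric])
    also have "prod_mset M = m" using \<open>m > 0\<close> by (simp add: M_def)
    finally have nk: "n * k = m" .
    have "p \<in># M \<and> p \<in> A" if "prime p" "p dvd n" for p
      using that unfolding n_def M_def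
      by (subst (asm) prime_dvd_prod_mset_primes_iff) auto
    moreover have "p \<in># M \<and> p \<notin> A" if "prime p" "p dvd k" for p
      using that unfolding k_def M_def
      by (subst (asm) prime_dvd_prod_mset_primes_iff) auto
    ultimately have "n \<in> numbers_over A" "k \<in> numbers_over B"
      using m \<open>m > 0\<close> unfolding nk[symmetric] numbers_over_def by auto
    then show "m \<in> (\<lambda>(n, k). n * k) ` (numbers_over A \<times> numbers_over B)"
      using nk by force
  qed
qed

lemma numbers_over_empty: "numbers_over {} = {1}"
proof (intro equalityI subsetI)
  fix n assume "n \<in> numbers_over {}"
  then show "n \<in> {1}" using prime_factor_nat[of n] by (auto simp: numbers_over_def)
qed (auto simp: numbers_over_def)

lemma numbers_over_singleton:
  assumes "prime p"
  shows "numbers_over {p} = range (\<lambda>k. p ^ k)"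
proof (intro equalityI subsetI)
  fix n assume n: "n \<in> numbers_over {p}"
  define m where "m = n div p ^ multiplicity p n"
  have "n \<noteq> 0" "\<not> is_unit p" using n assms by (auto simp: numbers_over_def)
  then have m: "n = p ^ multiplicity p n * m" "\<not> p dvd m"
    unfolding m_def by (simp_all add: multiplicity_dvd multiplicity_decompose)
  have "m = 1"
  proof (rule ccontr)
    assume "m \<noteq> 1"
    then obtain q where q: "prime q" "q dvd m" using prime_factor_nat by blast
    then have "q dvd n" using m(1) by (metis dvd_mult)
    then show False using n q m(2) by (auto simp: numbers_over_def)
  qed
  then show "n \<in> range (\<lambda>k. p ^ k)" using m(1) by auto
next
  fix n assume "n \<in> range (\<lambda>k. p ^ k)"
  then obtain k where k: "n = p ^ k" by auto
  have "q = p" if "prime q" "q dvd p ^ k" for q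
    using that assms prime_dvd_power primes_dvd_imp_eq by blast
  then show "n \<in> numbers_over {p}"
    using k prime_gt_0_nat[OF assms] by (simp add: numbers_over_def)
qed

text \<open>
  This Euler product is built one prime at a time. All terms are nonnegative, so the double sum over
  the integers composed of the earlier primes and the powers of the new one may be evaluated row by
  row.
\<close>

lemma has_sum_numbers_over:
  assumes "finite A" "\<And>p. p \<in> A \<Longrightarrow> prime p"
  shows "((\<lambda>n. 1 / real n) has_sum (\<Prod>p\<in>A. 1 / (1 - 1 / real p))) (numbers_over A)"
  using assms
proof (induction A rule: finite_induct)
  case empty
  show ?case by (simp add: numbers_over_empty has_sum_finite_iff)
next
  case (insert p A)
  define S where "S = (\<Prod>p\<in>A. 1 / (1 - 1 / real p))"
  define P where "P = 1 / (1 - 1 / real p)"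
  have p: "prime p" and p1: "1 < p" using insert.prems prime_gt_1_nat by auto
  have A: "((\<lambda>n. 1 / real n) has_sum S) (numbers_over A)"
    using insert by (simp add: S_def)
  have inj: "inj (\<lambda>k. p ^ k)" by (rule injI) (use p1 in simp)
  have "((\<lambda>k. (1 / real p) ^ k) has_sum P) UNIV"
    unfolding P_def using p1 by (intro sums_nonneg_imp_has_sum geometric_sums) auto
  also have "(\<lambda>k. (1 / real p) ^ k) = (\<lambda>n. 1 / real n) \<circ> (\<lambda>k. p ^ k)"
    by (simp add: fun_eq_iff power_one_over)
  finally have B: "((\<lambda>n. 1 / real n) has_sum P) (numbers_over {p})"
    using has_sum_reindex[OF inj, of "\<lambda>n. 1 / real n" P]
    by (simp only: numbers_over_singleton[OF p])
  define g where "g = (\<lambda>(n, k). 1 / real (n * k))"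
  have row: "((\<lambda>k. g (n, k)) has_sum (1 / real n * P)) (numbers_over {p})" for n
    using has_sum_cmult_right[OF B, of "1 / real n"] by (simp add: g_def)
  have col: "((\<lambda>n. 1 / real n * P) has_sum (S * P)) (numbers_over A)"
    by (rule has_sum_cmult_left[OF A])
  have "(g has_sum (S * P)) (numbers_over A \<times> numbers_over {p})"
    by (rule has_sum_SigmaI[OF row col summable_on_SigmaI[OF row has_sum_imp_summable[OF col]]])
      (simp add: g_def)
  also have "g = (\<lambda>z. 1 / real ((\<lambda>(n, k). n * k) z))"
    by (auto simp: g_def fun_eq_iff)
  finally have "((\<lambda>n. 1 / real n) has_sum (S * P)) (numbers_over (A \<union> {p}))"
    using has_sum_reindex_bij_betw[OF bij_betw_mult_numbers_over[of A "{p}"],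
        of "\<lambda>n. 1 / real n"] insert.hyps by simp
  then show ?case using insert.hyps by (simp add: S_def P_def mult.commute)
qed

lemma has_sum_smooth_numbers:
  "((\<lambda>n. 1 / real n) has_sum inverse (primes_prod y)) (smooth_numbers y)"
proof -
  have "finite {p. prime p \<and> real p \<le> y}"
    by (rule finite_subset[of _ "{..nat \<lfloor>y\<rfloor>}"]) (auto simp: le_nat_floor)
  from has_sum_numbers_over[OF this]
  have "((\<lambda>n. 1 / real n) has_sum (\<Prod>p | prime p \<and> real p \<le> y. 1 / (1 - 1 / real p))) (smooth_numbers y)"
    unfolding smooth_numbers_eq by blast
  then show ?thesis unfolding primes_prod_def inverse_eq_divide prod_dividef prod.neutral_const .
qed

lemma primes_prod_pos: "primes_prod y > 0"
  unfolding primes_prod_def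
proof (rule prod_pos)
  fix p assume "p \<in> {p. prime p \<and> real p \<le> y}"
  then show "0 < 1 - 1 / real p" using prime_gt_1_nat[of p] by simp
qed

lemma finite_nat_le_real: "finite {n. P n \<and> real n \<le> x}"
  by (rule finite_subset[of _ "{..nat \<lfloor>x\<rfloor>}"]) (auto simp: le_nat_floor)

text \<open>
  Both sides count the integers \<open>m\<close> with \<open>1 \<le> m \<le> x\<close>, the left side according to the smooth
  part of \<open>m\<close>.
\<close>

lemma sum_smooth_Phi:
  assumes "0 \<le> x"
  shows "(\<Sum>n | n \<in> smooth_numbers y \<and> real n \<le> x. real (Phi (x / real n) y)) = of_int \<lfloor>x\<rfloor>"
proof -
  define T where "T = {n. n \<in> smooth_numbers y \<and> real n \<le> x}"
  define B where "B = numbers_over {p. prime p \<and> y < real p}"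
  define C where "C = (SIGMA n:T. {k \<in> B. real k \<le> x / real n})"
  have T: "finite T" unfolding T_def by (rule finite_nat_le_real)
  have pos: "n > 0" if "n \<in> smooth_numbers y \<or> n \<in> B" for n
    using that by (auto simp: smooth_numbers_def B_def numbers_over_def)
  have "{p. prime p \<and> real p \<le> y} \<inter> {p. prime p \<and> y < real p} = {}" by auto
  from bij_betw_mult_numbers_over[OF this]
  have "bij_betw (\<lambda>(n, k). n * k) (smooth_numbers y \<times> B)
      (numbers_over ({p. prime p \<and> real p \<le> y} \<union> {p. prime p \<and> y < real p}))"
    by (simp add: smooth_numbers_eq B_def)
  also have "numbers_over ({p. prime p \<and> real p \<le> y} \<union> {p. prime p \<and> y < real p}) = {0<..}"
    by (auto simp: numbers_over_def)
  finally have bij: "bij_betw (\<lambda>(n, k). n * k) (smooth_numbers y \<times> B) {0<..}" .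
  have iff: "real k \<le> x / real n \<longleftrightarrow> real (n * k) \<le> x" if "n > 0" for n k
    using that by (simp add: field_simps)
  have le: "real n \<le> x" if "real (n * k) \<le> x" "k > 0" for n k
  proof -
    have "n \<le> n * k" using that(2) by simp
    then show ?thesis using that(1) by linarith
  qed
  have "bij_betw (\<lambda>(n, k). n * k) C {0<..nat \<lfloor>x\<rfloor>}"
  proof (rule bij_betw_subset[OF bij])
    show "C \<subseteq> smooth_numbers y \<times> B" by (auto simp: C_def T_def)
    have C: "(n, k) \<in> C \<longleftrightarrow> (n, k) \<in> smooth_numbers y \<times> B \<and> real (n * k) \<le> x" for n k
      using iff[of n k] le[of n k] pos[of n] pos[of k] by (auto simp: C_def T_def)
    have fl: "m \<le> nat \<lfloor>x\<rfloor> \<longleftrightarrow> real m \<le> x" for m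
      using assms by (simp add: le_nat_iff le_floor_iff)
    show "(\<lambda>(n, k). n * k) ` C = {0<..nat \<lfloor>x\<rfloor>}"
    proof (intro equalityI subsetI)
      fix m assume "m \<in> (\<lambda>(n, k). n * k) ` C"
      then obtain n k where m: "m = n * k" "(n, k) \<in> C" by auto
      then show "m \<in> {0<..nat \<lfloor>x\<rfloor>}" using C[of n k] pos[of n] pos[of k] fl[of m] by auto
    next
      fix m assume m: "m \<in> {0<..nat \<lfloor>x\<rfloor>}"
      then have "m \<in> (\<lambda>(n, k). n * k) ` (smooth_numbers y \<times> B)"
        using bij_betw_imp_surj_on[OF bij] by simp
      then obtain n k where "m = n * k" "(n, k) \<in> smooth_numbers y \<times> B" by auto
      then show "m \<in> (\<lambda>(n, k). n * k) ` C" using C[of n k] m fl[of m] by force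
    qed
  qed
  then have "card C = nat \<lfloor>x\<rfloor>" using bij_betw_same_card by fastforce
  moreover have "card C = (\<Sum>n\<in>T. Phi (x / real n) y)"
    unfolding C_def Phi_eq B_def using T finite_nat_le_real by simp
  ultimately have "(\<Sum>n\<in>T. Phi (x / real n) y) = nat \<lfloor>x\<rfloor>" by simp
  then have "(\<Sum>n\<in>T. real (Phi (x / real n) y)) = of_int \<lfloor>x\<rfloor>"
    using assms by (simp flip: of_nat_sum)
  then show ?thesis by (simp add: T_def)
qed

section \<open>Sums over smooth numbers\<close>

text \<open>
  A pointwise bound proportional to \<open>z\<close> survives the summation over smooth numbers at the cost of
  \<open>\<Sum> 1/n = \<Pi>(y)\<^sup>-\<^sup>1\<close>.
\<close>

lemma smooth_sum_bound:
  assumes x: "0 < x" "x \<le> X"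
    and q: "\<And>z. 0 < z \<Longrightarrow> z \<le> X \<Longrightarrow> \<bar>q z\<bar> \<le> z * c"
  shows "\<bar>\<Sum>\<^sub>\<infinity>n\<in>smooth_numbers y. q (x / real n)\<bar> \<le> x * c * inverse (primes_prod y)"
proof -
  have major: "((\<lambda>n. x * c * (1 / real n)) has_sum (x * c * inverse (primes_prod y))) (smooth_numbers y)"
    by (rule has_sum_cmult_right[OF has_sum_smooth_numbers])
  have bound: "norm (q (x / real n)) \<le> x * c * (1 / real n)" if "n \<in> smooth_numbers y" for n
  proof -
    have n: "n \<ge> 1" using that by (auto simp: smooth_numbers_def)
    then have "x / real n \<le> x / 1" using x by (intro divide_left_mono) auto
    then show ?thesis using q[of "x / real n"] x n by simp
  qed
  have "(\<lambda>n. q (x / real n)) summable_on smooth_numbers y"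
    by (rule Infinite_Sum.abs_summable_summable,
        rule Infinite_Sum.abs_summable_on_comparison_test'[OF has_sum_imp_summable[OF major] bound])
  then have "((\<lambda>n. q (x / real n)) has_sum (\<Sum>\<^sub>\<infinity>n\<in>smooth_numbers y. q (x / real n)))
      (smooth_numbers y)"
    by (rule has_sum_infsum)
  then have "norm (\<Sum>\<^sub>\<infinity>n\<in>smooth_numbers y. q (x / real n)) \<le> x * c * inverse (primes_prod y)"
    by (rule norm_infsum_le[OF _ major]) (rule bound)
  then show ?thesis by simp
qed

lemma Qstar_lt_1:
  assumes "0 < z" "z < 1" "1 < y"
  shows "Qstar z y = 0"
proof -
  have "ln z / ln y < 0" using assms by (simp add: divide_neg_pos)
  then have "mu y (ln z / ln y) = 0" by (simp add: mu_def)
  moreover have "{n::nat. 0 < n \<and> real n \<le> z \<and> (\<forall>p. prime p \<and> p dvd n \<longrightarrow> real p > y)} = {}"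
    using assms by auto
  then have "Phi z y = 0" unfolding Phi_def by (simp only: card.empty)
  ultimately show ?thesis using assms by (simp add: Qstar_def Vstar_def)
qed

lemma Qstar_1: "Qstar 1 y = 0"
proof -
  have "{n::nat. 0 < n \<and> real n \<le> 1 \<and> (\<forall>p. prime p \<and> p dvd n \<longrightarrow> real p > y)} = {1}" by auto
  then show ?thesis by (simp add: Qstar_def Vstar_def mu_def Phi_def)
qed

lemma Q_eq_Qstar: "Q z y = Qstar z y + z * (primes_prod y - exp (- euler_mascheroni) / ln y)"
  by (simp add: Q_def Qstar_def V_def Vstar_def algebra_simps)

lemma Rstar_has_sum:
  assumes "0 < x" "1 < y"
  defines "T \<equiv> {n. n \<in> smooth_numbers y \<and> real n \<le> x}"
  shows "((\<lambda>n. Qstar (x / real n) y) has_sum (\<Sum>n\<in>T. Qstar (x / real n) y)) (smooth_numbers y)"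
proof (rule has_sum_finite_neutralI[of T])
  show "finite T" unfolding T_def by (rule finite_nat_le_real)
  show "Qstar (x / real n) y = 0" if "n \<in> smooth_numbers y - T" for n
    by (rule Qstar_lt_1) (use that assms in \<open>auto simp: T_def smooth_numbers_def field_simps\<close>)
qed (auto simp: T_def)

lemma R_eq_Rstar:
  assumes "0 < x" "1 < y"
  shows "R x y = Rstar x y +
    x * ((primes_prod y - exp (- euler_mascheroni) / ln y) * inverse (primes_prod y))"
proof -
  define \<kappa> where "\<kappa> = primes_prod y - exp (- euler_mascheroni) / ln y"
  have "((\<lambda>n. Qstar (x / real n) y + x * \<kappa> * (1 / real n)) has_sum
      (Rstar x y + x * \<kappa> * inverse (primes_prod y))) (smooth_numbers y)"
    unfolding Rstar_def
    by (intro has_sum_add has_sum_infsum has_sum_imp_summable[OF Rstar_has_sum[OF assms]]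
        has_sum_cmult_right has_sum_smooth_numbers)
  then have "R x y = Rstar x y + x * \<kappa> * inverse (primes_prod y)"
    unfolding R_def by (intro infsumI) (simp add: Q_eq_Qstar \<kappa>_def)
  then show ?thesis by (simp add: \<kappa>_def mult.assoc)
qed

section \<open>The renewal equation for smooth numbers\<close>

definition causal_exp :: "real \<Rightarrow> real \<Rightarrow> real" where
  "causal_exp y v = (if v < 0 then 0 else y powr (- v))"

lemma causal_causal_exp: "0 < y \<Longrightarrow> causal (causal_exp y)"
proof (rule causal_continuous_on[of 0])
  assume "0 < y"
  then have "continuous_on {0..} (\<lambda>v. y powr (- v))" by (intro continuous_intros) auto
  then show "continuous_on {0..} (causal_exp y)"
    by (rule continuous_on_eq) (auto simp: causal_exp_def)
qed (auto simp: causal_exp_def)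

lemma mu_eq_conv:
  assumes "0 < y"
  shows "mu y u = conv buchstab (causal_exp y) u"
  unfolding mu_def conv_eq_integral[OF causal_buchstab causal_causal_exp[OF assms]]
  by (rule integral_cong) (simp add: causal_exp_def)

text \<open>
  In the variable \<open>v = ln x / ln y\<close> and after division by \<open>x = y\<^sup>v\<close>, the three quantities
  \<open>\<Psi>(x,y)\<close>, \<open>\<lfloor>x\<rfloor>\<close> and \<open>R\<^sup>*(x,y)\<close> become causal functions, so that their relation is a
  convolution equation.
\<close>

definition smooth_density :: "real \<Rightarrow> real \<Rightarrow> real" where
  "smooth_density y v = real (Psi (y powr v) y) * y powr (- v)"

definition floor_density :: "real \<Rightarrow> real \<Rightarrow> real" where
  "floor_density y v = of_int \<lfloor>y powr v\<rfloor> * y powr (- v)"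

definition Rstar_density :: "real \<Rightarrow> real \<Rightarrow> real" where
  "Rstar_density y v = Rstar (y powr v) y * y powr (- v)"

lemma powr_lt_1: "1 < y \<Longrightarrow> v < 0 \<Longrightarrow> y powr v < (1::real)"
  using powr_less_mono[of v 0 y] by simp

lemma causal_counting_density:
  assumes y: "1 < y" and "mono N" and N: "\<And>x. 0 < x \<Longrightarrow> 0 \<le> N x \<and> N x \<le> x"
    and N1: "\<And>x. 0 < x \<Longrightarrow> x < 1 \<Longrightarrow> N x = 0"
  shows "causal (\<lambda>v. N (y powr v) * y powr (- v))"
proof (rule causalI)
  have "mono (\<lambda>v. N (y powr v))"
    using y by (intro monoI monoD[OF \<open>mono N\<close>]) (simp add: powr_mono)
  note [measurable] = borel_measurable_mono[OF this]
  show "(\<lambda>v. N (y powr v) * y powr (- v)) \<in> borel_measurable borel" by measurable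
  show "N (y powr v) * y powr (- v) = 0" if "v < 0" for v
    using N1[of "y powr v"] powr_lt_1[OF y that] y by simp
  have "\<bar>N (y powr v) * y powr (- v)\<bar> \<le> 1" for v
  proof -
    have "N (y powr v) * y powr (- v) \<le> y powr v * y powr (- v)"
      using N[of "y powr v"] y by (intro mult_right_mono) auto
    also have "\<dots> = 1" using y by (simp flip: powr_add)
    finally show ?thesis using N[of "y powr v"] y by simp
  qed
  then show "\<exists>B. \<forall>v\<le>T. \<bar>N (y powr v) * y powr (- v)\<bar> \<le> B" for T by blast
qed

lemma causal_smooth_density:
  assumes y: "1 < y"
  shows "causal (smooth_density y)"
  unfolding smooth_density_def
proof (rule causal_counting_density[OF y])
  show "mono (\<lambda>x. real (Psi x y))"
    unfolding Psi_def by (intro monoI of_nat_mono card_mono finite_nat_le_real) auto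
  fix x :: real assume x: "0 < x"
  have sub: "{n \<in> smooth_numbers y. real n \<le> x} \<subseteq> {0<..nat \<lfloor>x\<rfloor>}"
    by (auto simp: smooth_numbers_def le_nat_floor)
  then have "Psi x y \<le> nat \<lfloor>x\<rfloor>"
    unfolding Psi_def using card_mono[OF _ sub] by simp
  then show "0 \<le> real (Psi x y) \<and> real (Psi x y) \<le> x" using x by linarith
  show "real (Psi x y) = 0" if "x < 1"
  proof -
    have "nat \<lfloor>x\<rfloor> = 0" using x that by linarith
    with \<open>Psi x y \<le> nat \<lfloor>x\<rfloor>\<close> show ?thesis by simp
  qed
qed

lemma causal_floor_density:
  assumes y: "1 < y"
  shows "causal (floor_density y)"
  unfolding floor_density_def
proof (rule causal_counting_density[OF y])
  show "mono (\<lambda>x::real. real_of_int \<lfloor>x\<rfloor>)" by (intro monoI) (simp add: floor_mono)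
  fix x :: real assume x: "0 < x"
  then show "0 \<le> real_of_int \<lfloor>x\<rfloor> \<and> real_of_int \<lfloor>x\<rfloor> \<le> x" by simp
  show "real_of_int \<lfloor>x\<rfloor> = 0" if "x < 1"
    using x that by (simp add: floor_eq_iff)
qed

text \<open>
  A smooth integer \<open>n\<close> contributes to \<open>\<Psi>(y\<^sup>v,y) y\<^sup>-\<^sup>v\<close> exactly from \<open>v = ln n / ln y\<close> on, and
  \<open>y\<^sup>-\<^sup>v\<close> is \<open>1/n\<close> times its own translate by that amount: the density is a superposition of
  translated exponentials, each of which turns into a value of \<open>\<mu>\<^sub>y\<close> under convolution
  with \<open>\<omega>\<close>.
\<close>

lemma smooth_density_eq_sum:
  assumes y: "1 < y" and v: "v \<le> u"
  shows "smooth_density y v = (\<Sum>n | n \<in> smooth_numbers y \<and> real n \<le> y powr u.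
    1 / real n * causal_exp y (v - ln (real n) / ln y))"
proof -
  define T where "T = {n. n \<in> smooth_numbers y \<and> real n \<le> y powr u}"
  have T: "finite T" unfolding T_def by (rule finite_nat_le_real)
  have summand: "1 / real n * causal_exp y (v - ln (real n) / ln y) =
      (if real n \<le> y powr v then y powr (- v) else 0)" if "n \<in> T" for n
  proof -
    have n: "0 < n" using that by (simp add: T_def smooth_numbers_def)
    have "y powr (ln (real n) / ln y) = real n" using y n by (simp add: powr_def)
    moreover have "v - ln (real n) / ln y < 0 \<longleftrightarrow> y powr v < y powr (ln (real n) / ln y)"
      using y by (subst powr_less_cancel_iff) auto
    moreover have "y powr (- (v - ln (real n) / ln y)) = y powr (- v) * y powr (ln (real n) / ln y)"
      by (simp flip: powr_add)
    ultimately show ?thesis using n by (auto simp: causal_exp_def)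
  qed
  have "y powr v \<le> y powr u" using y v by (simp add: powr_mono)
  then have "{n \<in> smooth_numbers y. real n \<le> y powr v} = {n \<in> T. real n \<le> y powr v}"
    by (auto simp: T_def)
  then have "smooth_density y v = (\<Sum>n | n \<in> T \<and> real n \<le> y powr v. y powr (- v))"
    by (simp add: smooth_density_def Psi_def)
  also have "\<dots> = (\<Sum>n\<in>T. if real n \<le> y powr v then y powr (- v) else 0)"
    by (rule sum.inter_filter[OF T])
  also have "\<dots> = (\<Sum>n\<in>T. 1 / real n * causal_exp y (v - ln (real n) / ln y))"
    by (rule sum.cong[OF refl summand[symmetric]])
  finally show ?thesis by (simp add: T_def)
qed

text \<open>
  Summing \<open>Q\<^sup>*(x/n,y)\<close> over the smooth \<open>n \<le> x\<close>, the three terms of \<open>Q\<^sup>*\<close> give \<open>\<Psi>(x,y)\<close>, the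
  convolution of \<open>\<omega>\<close> with the density of smooth numbers, and \<open>\<lfloor>x\<rfloor>\<close>, the last because the
  products of a smooth and a rough number run through the integers.
\<close>

lemma Rstar_density_eq:
  assumes y: "1 < y"
  shows "smooth_density y u + conv buchstab (smooth_density y) u =
    floor_density y u + Rstar_density y u"
proof -
  define x where "x = y powr u"
  define T where "T = {n. n \<in> smooth_numbers y \<and> real n \<le> x}"
  have x: "0 < x" and u: "ln x / ln y = u" using y by (auto simp: x_def ln_powr)
  have n: "1 \<le> n" if "n \<in> T" for n using that by (auto simp: T_def smooth_numbers_def)
  have log: "0 \<le> ln (real n) / ln y" if "n \<in> T" for n using n[OF that] y by simp
  have exp: "causal (\<lambda>t. causal_exp y (t - ln (real n) / ln y))" if "n \<in> T" for n
    by (rule causal_shift[OF causal_causal_exp log[OF that]]) (use y in simp)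
  have "conv buchstab (smooth_density y) u =
      conv buchstab (\<lambda>t. \<Sum>n\<in>T. 1 / real n * causal_exp y (t - ln (real n) / ln y)) u"
    by (rule conv_cong_right[OF causal_buchstab]) (simp add: smooth_density_eq_sum[OF y] T_def x_def)
  also have "\<dots> = (\<Sum>n\<in>T. 1 / real n *
      conv buchstab (\<lambda>t. causal_exp y (t - ln (real n) / ln y)) u)"
    by (rule conv_sum_right[OF causal_buchstab exp])
  also have "\<dots> = (\<Sum>n\<in>T. 1 / real n * mu y (ln (x / real n) / ln y))"
  proof (rule sum.cong[OF refl])
    fix n assume "n \<in> T"
    then have "u - ln (real n) / ln y = ln (x / real n) / ln y"
      using n[of n] x u by (simp add: ln_div diff_divide_distrib)
    then show "1 / real n * conv buchstab (\<lambda>t. causal_exp y (t - ln (real n) / ln y)) u =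
        1 / real n * mu y (ln (x / real n) / ln y)"
      using conv_shift_right[of buchstab "causal_exp y" "ln (real n) / ln y" u] y
      by (simp add: mu_eq_conv)
  qed
  finally have conv: "x * conv buchstab (smooth_density y) u =
      (\<Sum>n\<in>T. x / real n * mu y (ln (x / real n) / ln y))"
    by (simp add: sum_distrib_left)
  have "Rstar x y = (\<Sum>n\<in>T. Qstar (x / real n) y)"
    unfolding Rstar_def T_def by (rule infsumI[OF Rstar_has_sum[OF x y]])
  also have "\<dots> = (\<Sum>n\<in>T. 1 + x / real n * mu y (ln (x / real n) / ln y) - real (Phi (x / real n) y))"
  proof (rule sum.cong[OF refl])
    fix n assume "n \<in> T"
    then have "1 \<le> x / real n" using n[of n] by (simp add: T_def)
    then show "Qstar (x / real n) y =
        1 + x / real n * mu y (ln (x / real n) / ln y) - real (Phi (x / real n) y)"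
      by (simp add: Qstar_def Vstar_def)
  qed
  also have "\<dots> = real (card T) + x * conv buchstab (smooth_density y) u - of_int \<lfloor>x\<rfloor>"
    using sum_smooth_Phi[of x y] x by (simp add: sum.distrib sum_subtractf conv T_def)
  also have "card T = Psi x y" by (simp add: T_def Psi_def)
  finally have R: "Rstar x y = real (Psi x y) + x * conv buchstab (smooth_density y) u - of_int \<lfloor>x\<rfloor>" .
  have "Rstar x y * y powr (- u) = real (Psi x y) * y powr (- u) +
      (x * y powr (- u)) * conv buchstab (smooth_density y) u - of_int \<lfloor>x\<rfloor> * y powr (- u)"
    unfolding R by (simp add: algebra_simps)
  also have "x * y powr (- u) = 1" using y by (simp add: x_def flip: powr_add)
  finally show ?thesis
    by (simp add: Rstar_density_def smooth_density_def[of y u] floor_density_def x_def)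
qed

lemma causal_Rstar_density:
  assumes y: "1 < y"
  shows "causal (Rstar_density y)"
proof -
  have "Rstar_density y =
      (\<lambda>u. (smooth_density y u + conv buchstab (smooth_density y) u) - floor_density y u)"
    using Rstar_density_eq[OF y] by (simp add: fun_eq_iff)
  then show ?thesis
    using causal_diff[OF causal_add[OF causal_smooth_density[OF y]
        causal_conv[OF causal_buchstab causal_smooth_density[OF y]]] causal_floor_density[OF y]]
    by simp
qed

text \<open>
  The main term is what the renewal equation gives when \<open>R\<^sup>*\<close> is dropped: since
  \<open>\<lfloor>y\<^sup>v\<rfloor> y\<^sup>-\<^sup>v = 1 - {y\<^sup>v} y\<^sup>-\<^sup>v\<close> for \<open>v \<ge> 0\<close>, the constant \<open>1\<close> produces \<open>\<rho>(u)\<close> and the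
  fractional part the two correction terms of \<open>\<Lambda>\<close>.
\<close>

lemma Lambda_eq_floor_density:
  assumes y: "1 < y" and u: "0 \<le> u"
  shows "Lambda (y powr u) y = y powr u * (floor_density y u + conv dickman' (floor_density y) u)"
proof -
  have fl: "floor_density y v = 1 - frac (y powr v) / y powr v" for v
    using y by (simp add: floor_density_def frac_def powr_minus field_simps)
  have "((\<lambda>v. dickman' (u - v) * indicator {0..} v) has_integral dickman u - 1) {0..u}"
    using conv_has_integral[OF causal_dickman' causal_indicator[of 0], of u]
      conv_heaviside_dickman'[of u] u by (simp add: conv_commute[of dickman'])
  from has_integral_diff[OF this conv_has_integral[OF causal_dickman' causal_floor_density[OF y], of u]]
  have "((\<lambda>v. dickman' (u - v) * (frac (y powr v) / y powr v)) has_integral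
      dickman u - 1 - conv dickman' (floor_density y) u) {0..u}"
    by (rule has_integral_eq[rotated]) (simp add: fl algebra_simps)
  then have "integral {0..u} (\<lambda>v. dickman' (u - v) * (frac (y powr v) / y powr v)) =
      dickman u - 1 - conv dickman' (floor_density y) u"
    by (rule integral_unique)
  moreover have "ln (y powr u) / ln y = u" using y by (simp add: ln_powr)
  moreover have "y powr u * floor_density y u = y powr u - frac (y powr u)"
    using y by (simp add: fl right_diff_distrib)
  ultimately show ?thesis
    by (simp add: Lambda_def distrib_left right_diff_distrib)
qed

text \<open>The error term \<open>\<Delta>\<close> is therefore the image of \<open>R\<^sup>*\<close> under the inverse of \<open>\<delta> + \<omega>\<close>.\<close>

theorem Delta_eq_Rstar_density:
  assumes y: "1 < y" and u: "0 \<le> u"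
  shows "Delta (y powr u) y = y powr u * (Rstar_density y u + conv dickman' (Rstar_density y) u)"
proof -
  have "smooth_density y u = floor_density y u + Rstar_density y u +
      conv dickman' (\<lambda>t. floor_density y t + Rstar_density y t) u"
    by (rule buchstab_equation_inversion[OF causal_smooth_density[OF y] Rstar_density_eq[OF y]])
  also have "conv dickman' (\<lambda>t. floor_density y t + Rstar_density y t) u =
      conv dickman' (floor_density y) u + conv dickman' (Rstar_density y) u"
    using conv_add_left[OF causal_floor_density[OF y] causal_Rstar_density[OF y] causal_dickman', of u]
    by (simp add: conv_commute[of dickman'])
  finally have "y powr u * smooth_density y u = Lambda (y powr u) y +
      y powr u * (Rstar_density y u + conv dickman' (Rstar_density y) u)"
    by (simp add: Lambda_eq_floor_density[OF y u] distrib_left)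
  moreover have "y powr u * smooth_density y u = real (Psi (y powr u) y)"
    using y by (simp add: smooth_density_def powr_minus)
  ultimately show ?thesis by (simp add: Delta_def)
qed

text \<open>
  The parameter \<open>k\<close> serves the two versions of the error term at once: \<open>k = 0\<close> gives a bound in terms
  of \<open>R\<^sup>*\<close>, and the \<open>k\<close> for which \<open>R(z,y) = R\<^sup>*(z,y) + k z\<close> one in terms of \<open>R\<close>.
\<close>

lemma Delta_bound:
  assumes y: "1 < y" and x: "1 \<le> x" and k: "\<bar>k\<bar> \<le> A"
    and bound: "\<And>z. 0 < z \<Longrightarrow> z \<le> x \<Longrightarrow> \<bar>Rstar z y + z * k\<bar> \<le> z * A"
  shows "\<bar>Delta x y\<bar> \<le> 2 * x * A"
proof -
  define u where "u = ln x / ln y"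
  have u: "0 \<le> u" and yu: "y powr u = x" using x y by (auto simp: u_def powr_def)
  have "\<bar>Rstar_density y v + k\<bar> \<le> A" if "v \<le> u" for v
  proof -
    define z where "z = y powr v"
    have z: "0 < z" "z \<le> x" using y that by (auto simp: z_def simp flip: yu intro: powr_mono)
    have "Rstar_density y v + k = (Rstar z y + z * k) / z"
      using z by (simp add: Rstar_density_def powr_minus field_simps flip: z_def)
    then show ?thesis using bound[OF z] z by (simp add: pos_divide_le_eq mult.commute)
  qed
  then have "\<bar>Rstar_density y u + conv dickman' (Rstar_density y) u\<bar> \<le> 2 * A"
    by (intro dickman'_perturbation_bound[OF causal_Rstar_density[OF y] u k])
  then have "x * \<bar>Rstar_density y u + conv dickman' (Rstar_density y) u\<bar> \<le> x * (2 * A)"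
    using x by (intro mult_left_mono) auto
  moreover have "\<bar>Delta x y\<bar> = x * \<bar>Rstar_density y u + conv dickman' (Rstar_density y) u\<bar>"
    using Delta_eq_Rstar_density[OF y u] x by (simp add: yu abs_mult)
  ultimately show ?thesis by simp
qed

theorem corollary1:
  fixes X y :: real and f :: "real \<Rightarrow> real"
  assumes "X \<ge> 1" and "y \<ge> 2" and "f y > 0"
  shows "((\<forall>x. 1 \<le> x \<and> x \<le> X \<longrightarrow> \<bar>Q x y\<bar> \<le> x * f y) \<longrightarrow>
           (\<forall>x. 0 < x \<and> x \<le> X \<longrightarrow> \<bar>R x y\<bar> \<le> x * f y * inverse (primes_prod y)) \<and>
           (\<forall>x. 1 \<le> x \<and> x \<le> X \<longrightarrow> \<bar>Delta x y\<bar> \<le> 2 * x * f y * inverse (primes_prod y))) \<and>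
         ((\<forall>x. 1 \<le> x \<and> x \<le> X \<longrightarrow> \<bar>Qstar x y\<bar> \<le> x * f y) \<longrightarrow>
           (\<forall>x. 0 < x \<and> x \<le> X \<longrightarrow> \<bar>Rstar x y\<bar> \<le> x * f y * inverse (primes_prod y)) \<and>
           (\<forall>x. 1 \<le> x \<and> x \<le> X \<longrightarrow> \<bar>Delta x y\<bar> \<le> 2 * x * f y * inverse (primes_prod y)))"
proof -
  have y: "1 < y" using assms by simp
  define A where "A = f y * inverse (primes_prod y)"
  define \<kappa> where "\<kappa> = primes_prod y - exp (- euler_mascheroni) / ln y"
  define k where "k = \<kappa> * inverse (primes_prod y)"
  have part: "(\<forall>x. 0 < x \<and> x \<le> X \<longrightarrow> \<bar>r x\<bar> \<le> x * f y * inverse (primes_prod y)) \<and>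
      (\<forall>x. 1 \<le> x \<and> x \<le> X \<longrightarrow> \<bar>Delta x y\<bar> \<le> 2 * x * f y * inverse (primes_prod y))"
    if q: "\<And>z. 0 < z \<Longrightarrow> z \<le> X \<Longrightarrow> \<bar>q z\<bar> \<le> z * f y"
      and r: "\<And>x. r x = (\<Sum>\<^sub>\<infinity>n\<in>smooth_numbers y. q (x / real n))"
      and rk: "\<And>z. 0 < z \<Longrightarrow> r z = Rstar z y + z * l" and l: "\<bar>l\<bar> \<le> A" for q r :: "real \<Rightarrow> real" and l
  proof -
    have rbound: "\<bar>r z\<bar> \<le> z * f y * inverse (primes_prod y)" if "0 < z" "z \<le> X" for z
      unfolding r by (rule smooth_sum_bound[OF that q])
    have "\<bar>Delta x y\<bar> \<le> 2 * x * A" if "1 \<le> x" "x \<le> X" for x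
    proof (rule Delta_bound[OF y that(1) l])
      fix z assume z: "0 < z" "z \<le> x"
      then show "\<bar>Rstar z y + z * l\<bar> \<le> z * A"
        using rbound[of z] rk[of z] that by (simp add: A_def mult.assoc)
    qed
    with rbound show ?thesis by (simp add: A_def mult.assoc)
  qed
  have "(\<forall>x. 0 < x \<and> x \<le> X \<longrightarrow> \<bar>R x y\<bar> \<le> x * f y * inverse (primes_prod y)) \<and>
      (\<forall>x. 1 \<le> x \<and> x \<le> X \<longrightarrow> \<bar>Delta x y\<bar> \<le> 2 * x * f y * inverse (primes_prod y))"
    if Q: "\<forall>x. 1 \<le> x \<and> x \<le> X \<longrightarrow> \<bar>Q x y\<bar> \<le> x * f y"
  proof (rule part[where q = "\<lambda>z. Q z y" and l = k])
    (* All terms of Q(1,y) other than kappa cancel, so the hypothesis at x = 1 bounds kappa;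
       this takes care both of the range z < 1, where Q(z,y) = kappa z, and of the constant k. *)
    have \<kappa>: "\<bar>\<kappa>\<bar> \<le> f y"
      using Q[rule_format, of 1] assms(1) by (simp add: Q_eq_Qstar Qstar_1 \<kappa>_def)
    show "\<bar>Q z y\<bar> \<le> z * f y" if "0 < z" "z \<le> X" for z
    proof (cases "z < 1")
      case True
      then have "Q z y = z * \<kappa>"
        using that y by (simp add: Q_eq_Qstar Qstar_lt_1 \<kappa>_def)
      then show ?thesis using \<kappa> that by (simp add: abs_mult)
    qed (use Q that in auto)
    show "\<bar>k\<bar> \<le> A"
      using \<kappa> primes_prod_pos[of y] by (simp add: k_def A_def abs_mult mult_right_mono)
    show "R z y = Rstar z y + z * k" if "0 < z" for z
      using R_eq_Rstar[OF that y] by (simp add: k_def \<kappa>_def)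
  qed (simp add: R_def)
  moreover have "(\<forall>x. 0 < x \<and> x \<le> X \<longrightarrow> \<bar>Rstar x y\<bar> \<le> x * f y * inverse (primes_prod y)) \<and>
      (\<forall>x. 1 \<le> x \<and> x \<le> X \<longrightarrow> \<bar>Delta x y\<bar> \<le> 2 * x * f y * inverse (primes_prod y))"
    if Q: "\<forall>x. 1 \<le> x \<and> x \<le> X \<longrightarrow> \<bar>Qstar x y\<bar> \<le> x * f y"
  proof (rule part[where q = "\<lambda>z. Qstar z y" and l = 0])
    show "\<bar>Qstar z y\<bar> \<le> z * f y" if "0 < z" "z \<le> X" for z
      using Q that y Qstar_lt_1[of z y] assms(3) by (cases "z < 1") auto
    show "\<bar>0\<bar> \<le> A" using assms(3) primes_prod_pos[of y] by (simp add: A_def)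
  qed (simp_all add: Rstar_def)
  ultimately show ?thesis by blast
qed

end
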